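(* Let $p$ be a prime, $(I,<)$ a well-ordered set, $S$ a free pro-$p$ group with basis $(x_i)_{i\in I}$, and $\mathcal R$ a set of elements of $S_{(2)}$. Assume there exist $r\in\mathcal R$ and distinct $i,j,k\in I$ with $i<j$, $k<j$ such that: (1) in the canonical decomposition modulo $S_{(4)}$ of $r$, $u_{ij}=u_{kj}=u_{ki}=u_{kl}=u_{jl}=0$ for all $l\ne i,j,k$, $c_{ijk}\ne0$, and if $p=2$ also $a_k=a_j=0$; (2) for every $s\in\mathcal R$ different from $r$, the factors $[x_k,x_i]$, $[x_i,x_k]$ and $[x_i,x_j]$ do not occur in the canonical decomposition modulo $S_{(4)}$ of $s$. Then $G=S/\langle\mathcal R\rangle$ does not have the vanishing triple Massey product property with respect to $\mathbb{F}_p$.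
   Context: $[x,y]=x^{-1}y^{-1}xy$; $p$-Zassenhaus filtration $S_{(1)}=S$, $S_{(m)}=S_{(\lceil m/p\rceil)}^p\prod_{a+b=m}[S_{(a)},S_{(b)}]$; $\langle\mathcal R\rangle$ is the closed normal subgroup generated by $\mathcal R$. Canonical decomposition modulo $S_{(4)}$ of $r\in S_{(2)}$: the unique expression (products in a fixed order) $\prod_{i}x_i^{2a_i}\prod_{i<j}[x_i,x_j]^{b_{ij}}\prod_{i<j,k\le j}[[x_i,x_j],x_k]^{c_{ijk}}r'$ if $p=2$; $\prod_{i<j}[x_i,x_j]^{b_{ij}}\prod_{i}x_i^{3a_i}\prod_{i<j,k\le j}[[x_i,x_j],x_k]^{c_{ijk}}r'$ if $p=3$; $\prod_{i<j}[x_i,x_j]^{b_{ij}}\prod_{i<j,k\le j}[[x_i,x_j],x_k]^{c_{ijk}}r'$ if $p>3$; $a_i,b_{ij},c_{ijk}\in\{0,\dots,p-1\}$, $r'\in S_{(4)}$; a factor does not occur if its exponent is $0$. $u_{ij}=b_{ij}$ if $i<j$, $u_{ij}=b_{ji}$ if $j<i$. A profinite group $G$ has the vanishing triple Massey product property w.r.t. $\mathbb{F}_p$ if every defined triple Massey product $\langle\alpha_1,\alpha_2,\alpha_3\rangle$, $\alpha_i\in H^1(G,\mathbb{F}_p)$, contains $0$, where (in the DGA of inhomogeneous continuous cochains) a defining system is $(a_{ij})$, $1\le i<j\le4$, $(i,j)\ne(1,4)$, with $a_{i,i+1}$ representing $\alpha_i$, $\partial a_{13}=a_{12}\cup a_{23}$,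 $\partial a_{24}=a_{23}\cup a_{34}$, the value is the class of $a_{12}\cup a_{24}+a_{13}\cup a_{34}$, and the product is the set of values (defined if nonempty). *)

theory Defs
  imports
    "HOL-Algebra.Generated_Groups"
    "HOL-Analysis.Abstract_Topological_Spaces"
    "HOL-Computational_Algebra.Primes"
begin

section \<open>Profinite and pro-p groups\<close>

definition topological_group :: "'a monoid \<Rightarrow> 'a topology \<Rightarrow> bool" where
  "topological_group G T \<longleftrightarrow> group G \<and> topspace T = carrier G
     \<and> continuous_map (prod_topology T T) T (\<lambda>(x, y). x \<otimes>\<^bsub>G\<^esub> y)
     \<and> continuous_map T T (\<lambda>x. inv\<^bsub>G\<^esub> x)"

definition profinite_group :: "'a monoid \<Rightarrow> 'a topology \<Rightarrow> bool" where
  "profinite_group G T \<longleftrightarrow> topological_group G T \<and> compact_space T \<and> Hausdorff_space T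
     \<and> (\<forall>U. openin T U \<and> \<one>\<^bsub>G\<^esub> \<in> U \<longrightarrow> (\<exists>N. N \<lhd> G \<and> openin T N \<and> N \<subseteq> U))"

definition pro_p_group :: "nat \<Rightarrow> 'a monoid \<Rightarrow> 'a topology \<Rightarrow> bool" where
  "pro_p_group p G T \<longleftrightarrow> profinite_group G T
     \<and> (\<forall>N. N \<lhd> G \<and> openin T N \<longrightarrow> (\<exists>n. order (G Mod N) = p ^ n))"

definition closed_subgroup_generated :: "'a monoid \<Rightarrow> 'a topology \<Rightarrow> 'a set \<Rightarrow> 'a set" where
  "closed_subgroup_generated G T A = \<Inter> {H. subgroup H G \<and> closedin T H \<and> A \<subseteq> H}"

definition closed_normal_subgroup_generated :: "'a monoid \<Rightarrow> 'a topology \<Rightarrow> 'a set \<Rightarrow> 'a set" where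
  "closed_normal_subgroup_generated G T A = \<Inter> {N. N \<lhd> G \<and> closedin T N \<and> A \<subseteq> N}"

definition quotient_group_topology :: "'a monoid \<Rightarrow> 'a topology \<Rightarrow> 'a set \<Rightarrow> 'a set topology" where
  "quotient_group_topology G T N = topology (\<lambda>U. U \<subseteq> carrier (G Mod N)
     \<and> openin T {g \<in> carrier G. N #>\<^bsub>G\<^esub> g \<in> U})"

lemma openin_quotient_group_topology:
  "openin (quotient_group_topology G T N) U \<longleftrightarrow>
     U \<subseteq> carrier (G Mod N) \<and> openin T {g \<in> carrier G. N #>\<^bsub>G\<^esub> g \<in> U}"
proof -
  have "istopology (\<lambda>U. U \<subseteq> carrier (G Mod N) \<and> openin T {g \<in> carrier G. N #>\<^bsub>G\<^esub> g \<in> U})"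
    unfolding istopology_def
  proof (intro conjI allI impI; (elim conjE)?)
    fix U V
    assume "openin T {g \<in> carrier G. N #>\<^bsub>G\<^esub> g \<in> U}" "openin T {g \<in> carrier G. N #>\<^bsub>G\<^esub> g \<in> V}"
    then have "openin T ({g \<in> carrier G. N #>\<^bsub>G\<^esub> g \<in> U} \<inter> {g \<in> carrier G. N #>\<^bsub>G\<^esub> g \<in> V})"
      by blast
    then show "openin T {g \<in> carrier G. N #>\<^bsub>G\<^esub> g \<in> U \<inter> V}"
      by (rule back_subst[of "openin T"]) auto
  next
    fix K
    assume "\<forall>U\<in>K. U \<subseteq> carrier (G Mod N) \<and> openin T {g \<in> carrier G. N #>\<^bsub>G\<^esub> g \<in> U}"
    then have "openin T (\<Union>U\<in>K. {g \<in> carrier G. N #>\<^bsub>G\<^esub> g \<in> U})"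
      by blast
    then show "openin T {g \<in> carrier G. N #>\<^bsub>G\<^esub> g \<in> \<Union>K}"
      by (rule back_subst[of "openin T"]) auto
  qed blast+
  then show ?thesis
    by (simp add: quotient_group_topology_def topology_inverse')
qed


section \<open>Free pro-p groups\<close>

definition converges_to_one :: "'a monoid \<Rightarrow> 'a topology \<Rightarrow> ('i \<Rightarrow> 'a) \<Rightarrow> bool" where
  "converges_to_one G T x \<longleftrightarrow> (\<forall>N. N \<lhd> G \<and> openin T N \<longrightarrow> finite {i. x i \<notin> N})"

text \<open>The basis is indexed by the whole type \<^typ>\<open>'i\<close>.  As usual for pro-p groups, a basis
  converges to 1, and the maps to be extended converge to 1.  HOL cannot quantify over groups of
  every type, so the extension property is required for finite p-groups, which up to isomorphism
  live on \<^typ>\<open>nat\<close>.  The theorem \<open>free_pro_p_group_universal\<close> below derives from this the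
  universal property with respect to all pro-p groups.\<close>

definition free_pro_p_group :: "nat \<Rightarrow> 'a monoid \<Rightarrow> 'a topology \<Rightarrow> ('i \<Rightarrow> 'a) \<Rightarrow> bool" where
  "free_pro_p_group p S T x \<longleftrightarrow> pro_p_group p S T
     \<and> range x \<subseteq> carrier S \<and> converges_to_one S T x
     \<and> closed_subgroup_generated S T (range x) = carrier S
     \<and> (\<forall>(P :: nat monoid) f. group P \<and> finite (carrier P) \<and> (\<exists>n. order P = p ^ n)
          \<and> range f \<subseteq> carrier P \<and> finite {i. f i \<noteq> \<one>\<^bsub>P\<^esub>} \<longrightarrow>
          (\<exists>\<phi>. \<phi> \<in> hom S P \<and> continuous_map T (discrete_topology (carrier P)) \<phi>
             \<and> (\<forall>i. \<phi> (x i) = f i)))"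


lemma open_coset:
  assumes G: "topological_group G T" and N: "subgroup N G" "openin T N" and a: "a \<in> carrier G"
  shows "openin T (N #>\<^bsub>G\<^esub> a)"
proof -
  interpret group G
    using G by (simp add: topological_group_def)
  interpret N: subgroup N G
    by (fact N)
  have top: "topspace T = carrier G"
    and mul: "continuous_map (prod_topology T T) T (\<lambda>(x, y). x \<otimes>\<^bsub>G\<^esub> y)"
    using G by (auto simp: topological_group_def)
  have "continuous_map T (prod_topology T T) (\<lambda>g. (g, inv\<^bsub>G\<^esub> a))"
    using a top by (intro continuous_map_pairedI) auto
  from continuous_map_compose[OF this mul]
  have "continuous_map T T (\<lambda>g. g \<otimes>\<^bsub>G\<^esub> inv\<^bsub>G\<^esub> a)"
    by (simp add: o_def)
  then have "openin T {g \<in> topspace T. g \<otimes>\<^bsub>G\<^esub> inv\<^bsub>G\<^esub> a \<in> N}"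
    using N(2) by (rule openin_continuous_map_preimage)
  moreover have "{g \<in> topspace T. g \<otimes>\<^bsub>G\<^esub> inv\<^bsub>G\<^esub> a \<in> N} = N #>\<^bsub>G\<^esub> a"
    using N.rcos_module[OF is_group a] r_coset_subset_G[OF N.subset a] top by auto
  ultimately show ?thesis
    by simp
qed

lemma closed_coset:
  assumes G: "topological_group G T" and N: "subgroup N G" "openin T N" and a: "a \<in> carrier G"
  shows "closedin T (N #>\<^bsub>G\<^esub> a)"
proof -
  interpret group G
    using G by (simp add: topological_group_def)
  interpret N: subgroup N G
    by (fact N)
  have top: "topspace T = carrier G"
    using G by (auto simp: topological_group_def)
  have sub: "N #>\<^bsub>G\<^esub> a \<subseteq> carrier G"
    by (rule r_coset_subset_G[OF N.subset a])
  have "carrier G - (N #>\<^bsub>G\<^esub> a) = (\<Union>b\<in>carrier G - (N #>\<^bsub>G\<^esub> a). N #>\<^bsub>G\<^esub> b)"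
  proof (intro subset_antisym subsetI)
    fix y assume "y \<in> carrier G - (N #>\<^bsub>G\<^esub> a)"
    then show "y \<in> (\<Union>b\<in>carrier G - (N #>\<^bsub>G\<^esub> a). N #>\<^bsub>G\<^esub> b)"
      using rcos_self[OF _ N(1)] by blast
  next
    fix y assume "y \<in> (\<Union>b\<in>carrier G - (N #>\<^bsub>G\<^esub> a). N #>\<^bsub>G\<^esub> b)"
    then obtain b where b: "b \<in> carrier G" "b \<notin> N #>\<^bsub>G\<^esub> a" "y \<in> N #>\<^bsub>G\<^esub> b"
      by blast
    then have y: "y \<in> carrier G" "N #>\<^bsub>G\<^esub> b = N #>\<^bsub>G\<^esub> y"
      using r_coset_subset_G[OF N.subset b(1)] repr_independence[OF b(3,1) N(1)] by auto
    have "y \<notin> N #>\<^bsub>G\<^esub> a"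
      using repr_independence[OF _ a N(1), of y] y(2) rcos_self[OF b(1) N(1)] b(2) by auto
    with y show "y \<in> carrier G - (N #>\<^bsub>G\<^esub> a)"
      by simp
  qed
  moreover have "openin T (\<Union>b\<in>carrier G - (N #>\<^bsub>G\<^esub> a). N #>\<^bsub>G\<^esub> b)"
    using open_coset[OF G N] by blast
  ultimately show ?thesis
    using sub top by (simp add: closedin_def)
qed

lemma topologically_generated_induct:
  assumes "closed_subgroup_generated S T (range x) = carrier S"
    and "subgroup D S" "closedin T D" "\<And>i. x i \<in> D"
  shows "carrier S \<subseteq> D"
proof -
  have "closed_subgroup_generated S T (range x) \<subseteq> D"
    unfolding closed_subgroup_generated_def using assms(2-4) by (intro Inter_lower) auto
  then show ?thesis
    by (simp add: assms(1))
qed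

lemma free_pro_p_group_finite_quotient:
  fixes S :: "'a monoid" and G :: "'b monoid" and x :: "'i \<Rightarrow> 'a"
  assumes p: "prime p" and S: "free_pro_p_group p S T x" and G: "pro_p_group p G U"
    and f: "range f \<subseteq> carrier G" "converges_to_one G U f"
    and N: "N \<lhd> G" "openin U N"
  shows "\<exists>\<psi>. \<psi> \<in> hom S (G Mod N) \<and> continuous_map T (discrete_topology (carrier (G Mod N))) \<psi>
           \<and> (\<forall>i. \<psi> (x i) = N #>\<^bsub>G\<^esub> f i)"
proof -
  interpret N: normal N G
    by (fact N)
  let ?Q = "G Mod N"
  have Q: "group ?Q"
    by (rule N.factorgroup_is_group)
  obtain n where n: "order ?Q = p ^ n"
    using G N unfolding pro_p_group_def by blast
  have "order ?Q > 0"
    unfolding n by (rule zero_less_power[OF prime_gt_0_nat[OF p]])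
  then have fin: "finite (carrier ?Q)"
    by (simp add: order_def card_gt_0_iff)
  from finite_imp_inj_to_nat_seg[OF this]
  obtain e :: "'b set \<Rightarrow> nat" where inj: "inj_on e (carrier ?Q)"
    by auto
  define P where "P = flatten ?Q e"
  have cP: "carrier P = e ` carrier ?Q"
    by (simp add: P_def flatten_def)
  have P: "group P"
    unfolding P_def by (rule flatten_set_group[OF Q inj])
  have e: "e \<in> hom ?Q P"
    unfolding P_def by (rule flatten_set_group_hom[OF Q inj])
  have finP: "finite (carrier P)"
    using fin by (simp add: cP)
  have "order P = p ^ n"
    using n inj by (simp add: cP order_def card_image)
  then have ordP: "\<exists>n. order P = p ^ n"
    by blast
  have fQ: "N #>\<^bsub>G\<^esub> f i \<in> carrier ?Q" for i
    using f(1) by (auto simp: FactGroup_def RCOSETS_def)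
  then have ran: "range (\<lambda>i. e (N #>\<^bsub>G\<^esub> f i)) \<subseteq> carrier P"
    by (auto simp: cP)
  have "e (N #>\<^bsub>G\<^esub> f i) = \<one>\<^bsub>P\<^esub>" if "f i \<in> N" for i
    using N.rcos_const[OF N.is_group that] by (simp add: P_def flatten_def FactGroup_def)
  then have "{i. e (N #>\<^bsub>G\<^esub> f i) \<noteq> \<one>\<^bsub>P\<^esub>} \<subseteq> {i. f i \<notin> N}"
    by blast
  moreover have "finite {i. f i \<notin> N}"
    using f(2) N by (simp add: converges_to_one_def)
  ultimately have almost: "finite {i. e (N #>\<^bsub>G\<^esub> f i) \<noteq> \<one>\<^bsub>P\<^esub>}"
    by (rule finite_subset)
  note extend = S[unfolded free_pro_p_group_def, THEN conjunct2, THEN conjunct2, THEN conjunct2,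
      THEN conjunct2, THEN spec[of _ P], THEN spec[of _ "\<lambda>i. e (N #>\<^bsub>G\<^esub> f i)"], THEN mp]
  obtain \<phi> where \<phi>: "\<phi> \<in> hom S P" "continuous_map T (discrete_topology (carrier P)) \<phi>"
      "\<And>i. \<phi> (x i) = e (N #>\<^bsub>G\<^esub> f i)"
    using extend[OF conjI[OF P conjI[OF finP conjI[OF ordP conjI[OF ran almost]]]]]
    by (elim exE conjE) auto
  let ?d = "inv_into (carrier ?Q) e"
  have "e \<in> iso ?Q P"
    using e inj by (simp add: iso_def bij_betw_def cP)
  then have d: "?d \<in> hom P ?Q"
    using group.iso_set_sym[OF Q] by (auto simp: iso_def)
  have "?d \<circ> \<phi> \<in> hom S ?Q"
    using \<phi>(1) d by (rule hom_compose)
  moreover have "continuous_map T (discrete_topology (carrier ?Q)) (?d \<circ> \<phi>)"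
    by (rule continuous_map_compose[OF \<phi>(2)]) (use d in \<open>auto simp: hom_def\<close>)
  moreover have "(?d \<circ> \<phi>) (x i) = N #>\<^bsub>G\<^esub> f i" for i
    using \<phi>(3) inj fQ by simp
  ultimately show ?thesis
    by blast
qed

theorem free_pro_p_group_universal:
  fixes S :: "'a monoid" and G :: "'b monoid" and x :: "'i \<Rightarrow> 'a"
  assumes p: "prime p" and S: "free_pro_p_group p S T x" and G: "pro_p_group p G U"
    and f: "range f \<subseteq> carrier G" "converges_to_one G U f"
  shows "\<exists>!\<phi>. \<phi> \<in> hom S G \<and> \<phi> \<in> extensional (carrier S) \<and> continuous_map T U \<phi>
           \<and> (\<forall>i. \<phi> (x i) = f i)"
proof -
  have tS: "topological_group S T" and tG: "topological_group G U"
    and cU: "compact_space U" and hU: "Hausdorff_space U"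
    and base: "\<And>V. openin U V \<Longrightarrow> \<one>\<^bsub>G\<^esub> \<in> V \<Longrightarrow> \<exists>N. N \<lhd> G \<and> openin U N \<and> N \<subseteq> V"
    using S G by (auto simp: free_pro_p_group_def pro_p_group_def profinite_group_def)
  interpret S: group S
    using tS by (simp add: topological_group_def)
  interpret G: group G
    using tG by (simp add: topological_group_def)
  have top: "topspace T = carrier S" "topspace U = carrier G"
    using tS tG by (auto simp: topological_group_def)
  have xS: "x i \<in> carrier S" for i
    using S by (auto simp: free_pro_p_group_def)
  have fG: "f i \<in> carrier G" for i
    using f by auto
  have gen: "carrier S \<subseteq> D" if "subgroup D S" "closedin T D" "\<And>i. x i \<in> D" for D
    using topologically_generated_induct[of S T x D] that S by (auto simp: free_pro_p_group_def)
  define ON where "ON = {N. N \<lhd> G \<and> openin U N}"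
  have ONs: "subgroup N G" if "N \<in> ON" for N
    using that normal_imp_subgroup by (auto simp: ON_def)
  have "\<forall>N\<in>ON. \<exists>\<psi>. \<psi> \<in> hom S (G Mod N)
      \<and> continuous_map T (discrete_topology (carrier (G Mod N))) \<psi> \<and> (\<forall>i. \<psi> (x i) = N #>\<^bsub>G\<^esub> f i)"
    using free_pro_p_group_finite_quotient[OF p S G f] by (auto simp: ON_def)
  from bchoice[OF this] obtain \<psi> where hom: "\<And>N. N \<in> ON \<Longrightarrow> \<psi> N \<in> hom S (G Mod N)"
    and cont: "\<And>N. N \<in> ON \<Longrightarrow> continuous_map T (discrete_topology (carrier (G Mod N))) (\<psi> N)"
    and \<psi>x: "\<And>N i. N \<in> ON \<Longrightarrow> \<psi> N (x i) = N #>\<^bsub>G\<^esub> f i"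
    by blast
  have car: "\<exists>g\<in>carrier G. \<psi> N s = N #>\<^bsub>G\<^esub> g" if "N \<in> ON" "s \<in> carrier S" for N s
    using hom_in_carrier[OF hom[OF that(1)] that(2)] by (auto simp: FactGroup_def RCOSETS_def)
  have mult: "\<psi> N (s \<otimes>\<^bsub>S\<^esub> t) = \<psi> N s <#>\<^bsub>G\<^esub> \<psi> N t"
    if "N \<in> ON" "s \<in> carrier S" "t \<in> carrier S" for N s t
    using hom_mult[OF hom[OF that(1)] that(2,3)] by (simp add: FactGroup_def)
  have one: "\<psi> N \<one>\<^bsub>S\<^esub> = N" if "N \<in> ON" for N
  proof -
    interpret N: normal N G
      using that by (simp add: ON_def)
    show ?thesis
      using hom_one[OF hom[OF that] S.is_group N.factorgroup_is_group] by (simp add: FactGroup_def)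
  qed
  have inv: "\<psi> N (inv\<^bsub>S\<^esub> s) = set_inv\<^bsub>G\<^esub> (\<psi> N s)" if "N \<in> ON" "s \<in> carrier S" for N s
  proof -
    interpret N: normal N G
      using that by (simp add: ON_def)
    interpret h: group_hom S "G Mod N" "\<psi> N"
      using hom[OF that(1)] S.is_group N.factorgroup_is_group
      by (simp add: group_hom_def group_hom_axioms_def)
    show ?thesis
      using h.hom_inv[OF that(2)] N.inv_FactGroup h.hom_closed[OF that(2)] by simp
  qed
  have pre: "closedin T {s \<in> carrier S. \<psi> N s \<in> A}" "openin T {s \<in> carrier S. \<psi> N s \<in> A}"
    if "N \<in> ON" for N A
  proof -
    have *: "{s \<in> carrier S. \<psi> N s \<in> A} = {s \<in> topspace T. \<psi> N s \<in> A \<inter> carrier (G Mod N)}"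
      using hom[OF that] by (auto simp: hom_def top)
    show "closedin T {s \<in> carrier S. \<psi> N s \<in> A}"
      unfolding * by (rule closedin_continuous_map_preimage[OF cont[OF that]]) simp
    show "openin T {s \<in> carrier S. \<psi> N s \<in> A}"
      unfolding * by (rule openin_continuous_map_preimage[OF cont[OF that]]) simp
  qed
  have mono: "\<psi> M s \<subseteq> \<psi> N s" if MN: "M \<in> ON" "N \<in> ON" "M \<subseteq> N" and s: "s \<in> carrier S" for M N s
  proof -
    let ?D = "{s \<in> carrier S. \<psi> M s \<subseteq> \<psi> N s}"
    have "subgroup ?D S"
    proof (rule S.subgroupI)
      show "?D \<noteq> {}"
        using one MN by force
      show "inv\<^bsub>S\<^esub> s \<in> ?D" if "s \<in> ?D" for s
        using that MN by (auto simp: inv SET_INV_def)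
      show "s \<otimes>\<^bsub>S\<^esub> t \<in> ?D" if "s \<in> ?D" "t \<in> ?D" for s t
        using that MN mono_set_mult[of "\<psi> M s" "\<psi> N s" "\<psi> M t" "\<psi> N t" G] by (simp add: mult)
    qed blast
    moreover have "closedin T ?D"
    proof -
      have "openin T (\<Union>C. {s \<in> carrier S. \<psi> M s \<in> {C}} \<inter> {s \<in> carrier S. \<psi> N s \<in> {E. \<not> C \<subseteq> E}})"
        using pre(2)[OF MN(1)] pre(2)[OF MN(2)] by (intro openin_Union) blast
      moreover have "(\<Union>C. {s \<in> carrier S. \<psi> M s \<in> {C}} \<inter> {s \<in> carrier S. \<psi> N s \<in> {E. \<not> C \<subseteq> E}})
          = topspace T - ?D"
        by (auto simp: top)
      ultimately show ?thesis
        by (simp add: closedin_def top)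
    qed
    moreover have "x i \<in> ?D" for i
      using MN xS by (auto simp: \<psi>x r_coset_def)
    ultimately show ?thesis
      using gen[of ?D] s by blast
  qed
  have car_ON: "carrier G \<in> ON"
    using openin_topspace[of U] G.normal_self unfolding ON_def top by simp
  have int_ON: "M \<inter> N \<in> ON" if "M \<in> ON" "N \<in> ON" for M N
    using that G.normal_subgroup_intersect[of M N] by (simp add: ON_def openin_Int)
  have ex: "\<exists>y. \<forall>N\<in>ON. y \<in> \<psi> N s" if s: "s \<in> carrier S" for s
  proof -
    have "\<Inter> ((\<lambda>N. \<psi> N s) ` ON) \<noteq> {}"
    proof (rule cU[unfolded compact_space_fip, rule_format], intro conjI ballI allI impI)
      fix C assume "C \<in> (\<lambda>N. \<psi> N s) ` ON"
      then obtain N where N: "N \<in> ON" "C = \<psi> N s"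
        by blast
      obtain g where g: "g \<in> carrier G" "\<psi> N s = N #>\<^bsub>G\<^esub> g"
        using car[OF N(1) s] by blast
      have "openin U N"
        using N(1) by (simp add: ON_def)
      then show "closedin U C"
        using closed_coset[OF tG ONs[OF N(1)] _ g(1)] by (simp add: N(2) g(2))
    next
      fix \<F> assume "finite \<F> \<and> \<F> \<subseteq> (\<lambda>N. \<psi> N s) ` ON"
      then obtain \<N> where \<N>: "finite \<N>" "\<N> \<subseteq> ON" "\<F> = (\<lambda>N. \<psi> N s) ` \<N>"
        using finite_subset_image[of \<F> "\<lambda>N. \<psi> N s" ON] by auto
      have "\<exists>M\<in>ON. \<forall>N\<in>\<N>. M \<subseteq> N"
        using \<N>(1,2)
      proof (induction \<N>)
        case empty
        then show ?case using car_ON by blast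
      next
        case (insert N \<N>)
        then obtain M where "M \<in> ON" "\<forall>N\<in>\<N>. M \<subseteq> N" by blast
        then show ?case
          using insert.prems int_ON[of M N] by (intro bexI[of _ "M \<inter> N"]) auto
      qed
      then obtain M where M: "M \<in> ON" "\<And>N. N \<in> \<N> \<Longrightarrow> M \<subseteq> N" by blast
      obtain g where "g \<in> carrier G" "\<psi> M s = M #>\<^bsub>G\<^esub> g"
        using car[OF M(1) s] by blast
      then have "g \<in> \<psi> M s"
        using G.rcos_self ONs[OF M(1)] by simp
      then have "g \<in> \<psi> N s" if "N \<in> \<N>" for N
        using mono[OF M(1) _ M(2)[OF that] s] that \<N>(2) by blast
      then have "g \<in> \<Inter>\<F>"
        unfolding \<N>(3) by (rule INT_I)
      then show "\<Inter>\<F> \<noteq> {}" by blast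
    qed
    then show ?thesis by blast
  qed
  define \<phi> where "\<phi> = (\<lambda>s\<in>carrier S. SOME y. \<forall>N\<in>ON. y \<in> \<psi> N s)"
  have \<phi>: "\<phi> s \<in> \<psi> N s" if "s \<in> carrier S" "N \<in> ON" for s N
    using someI_ex[OF ex[OF that(1)]] that by (simp add: \<phi>_def)
  have \<psi>sub: "\<psi> N s \<subseteq> carrier G" if "N \<in> ON" "s \<in> carrier S" for N s
    using car[OF that] G.r_coset_subset_G[OF subgroup.subset[OF ONs[OF that(1)]]] by auto
  have \<phi>G: "\<phi> s \<in> carrier G" if "s \<in> carrier S" for s
    using \<phi>[OF that car_ON] \<psi>sub[OF car_ON that] by blast
  have \<psi>\<phi>: "\<psi> N s = N #>\<^bsub>G\<^esub> \<phi> s" if "N \<in> ON" "s \<in> carrier S" for N s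
    using car[OF that] \<phi>[OF that(2,1)] G.repr_independence[OF _ _ ONs[OF that(1)]] by auto
  have eqI: "y = z" if yz: "y \<in> carrier G" "z \<in> carrier G" "\<And>N. N \<in> ON \<Longrightarrow> y \<in> N #>\<^bsub>G\<^esub> z" for y z
  proof (rule ccontr)
    assume "y \<noteq> z"
    then have "y \<otimes>\<^bsub>G\<^esub> inv\<^bsub>G\<^esub> z \<noteq> \<one>\<^bsub>G\<^esub>"
      using yz G.inv_solve_right'[of "\<one>\<^bsub>G\<^esub>" y z] by auto
    then obtain V W where "openin U V" "openin U W" "\<one>\<^bsub>G\<^esub> \<in> V" "y \<otimes>\<^bsub>G\<^esub> inv\<^bsub>G\<^esub> z \<in> W" "disjnt V W"
      using hU[unfolded Hausdorff_space_def, rule_format, of "\<one>\<^bsub>G\<^esub>" "y \<otimes>\<^bsub>G\<^esub> inv\<^bsub>G\<^esub> z"] yz top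
      by auto
    then obtain N where N: "N \<in> ON" "y \<otimes>\<^bsub>G\<^esub> inv\<^bsub>G\<^esub> z \<notin> N"
      using base[of V] by (auto simp: ON_def disjnt_def)
    then show False
      using yz subgroup.rcos_module[OF ONs[OF N(1)] G.is_group yz(2,1)] by blast
  qed
  have "\<phi> \<in> hom S G"
  proof (rule homI)
    show "\<phi> s \<in> carrier G" if "s \<in> carrier S" for s
      using that by (rule \<phi>G)
    show "\<phi> (s \<otimes>\<^bsub>S\<^esub> t) = \<phi> s \<otimes>\<^bsub>G\<^esub> \<phi> t" if st: "s \<in> carrier S" "t \<in> carrier S" for s t
    proof (rule eqI)
      fix N assume N: "N \<in> ON"
      then have "\<phi> (s \<otimes>\<^bsub>S\<^esub> t) \<in> \<psi> N s <#>\<^bsub>G\<^esub> \<psi> N t"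
        using \<phi>[of "s \<otimes>\<^bsub>S\<^esub> t" N] st mult by simp
      also have "\<dots> = N #>\<^bsub>G\<^esub> (\<phi> s \<otimes>\<^bsub>G\<^esub> \<phi> t)"
        using N st \<phi>G by (simp add: \<psi>\<phi> ON_def normal.rcos_sum)
      finally show "\<phi> (s \<otimes>\<^bsub>S\<^esub> t) \<in> N #>\<^bsub>G\<^esub> (\<phi> s \<otimes>\<^bsub>G\<^esub> \<phi> t)" .
    qed (use st \<phi>G in auto)
  qed
  moreover have "\<phi> \<in> extensional (carrier S)"
    by (simp add: \<phi>_def)
  moreover have "continuous_map T U \<phi>"
    unfolding continuous_map_def
  proof (intro conjI allI impI)
    show "\<phi> \<in> topspace T \<rightarrow> topspace U"
      using \<phi>G top by auto
    fix V assume V: "openin U V"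
    show "openin T {s \<in> topspace T. \<phi> s \<in> V}"
    proof (subst openin_subopen, intro ballI)
      fix s assume "s \<in> {s \<in> topspace T. \<phi> s \<in> V}"
      then have s: "s \<in> carrier S" "\<phi> s \<in> V"
        by (auto simp: top)
      have "continuous_map U (prod_topology U U) (\<lambda>g. (g, \<phi> s))"
        using \<phi>G[OF s(1)] top by (intro continuous_map_pairedI) auto
      moreover have "continuous_map (prod_topology U U) U (\<lambda>(x, y). x \<otimes>\<^bsub>G\<^esub> y)"
        using tG by (simp add: topological_group_def)
      ultimately have "continuous_map U U (\<lambda>g. g \<otimes>\<^bsub>G\<^esub> \<phi> s)"
        using continuous_map_compose[of U "prod_topology U U" "\<lambda>g. (g, \<phi> s)" U "\<lambda>(x, y). x \<otimes>\<^bsub>G\<^esub> y"]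
        by (simp add: o_def)
      then have "openin U {g \<in> topspace U. g \<otimes>\<^bsub>G\<^esub> \<phi> s \<in> V}"
        using V by (rule openin_continuous_map_preimage)
      then obtain N where N: "N \<in> ON" "N \<subseteq> {g \<in> topspace U. g \<otimes>\<^bsub>G\<^esub> \<phi> s \<in> V}"
        using base[of "{g \<in> topspace U. g \<otimes>\<^bsub>G\<^esub> \<phi> s \<in> V}"] s \<phi>G[OF s(1)] top by (auto simp: ON_def)
      then have "N #>\<^bsub>G\<^esub> \<phi> s \<subseteq> V"
        by (auto simp: r_coset_def)
      then have "{t \<in> carrier S. \<psi> N t \<in> {\<psi> N s}} \<subseteq> {s \<in> topspace T. \<phi> s \<in> V}"
        using \<phi>[OF _ N(1)] \<psi>\<phi>[OF N(1) s(1)] top by auto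
      then show "\<exists>W. openin T W \<and> s \<in> W \<and> W \<subseteq> {s \<in> topspace T. \<phi> s \<in> V}"
        using pre(2)[OF N(1), of "{\<psi> N s}"] s(1) by blast
    qed
  qed
  moreover have "\<phi> (x i) = f i" for i
    using \<phi>[OF xS] \<psi>x fG \<phi>G[OF xS] by (intro eqI) auto
  moreover have "\<phi>1 = \<phi>2"
    if 1: "\<phi>1 \<in> hom S G" "\<phi>1 \<in> extensional (carrier S)" "continuous_map T U \<phi>1" "\<And>i. \<phi>1 (x i) = f i"
      and 2: "\<phi>2 \<in> hom S G" "\<phi>2 \<in> extensional (carrier S)" "continuous_map T U \<phi>2" "\<And>i. \<phi>2 (x i) = f i"
    for \<phi>1 \<phi>2
  proof -
    interpret h1: group_hom S G \<phi>1
      by unfold_locales (fact 1)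
    interpret h2: group_hom S G \<phi>2
      by unfold_locales (fact 2)
    let ?D = "{s \<in> carrier S. \<phi>1 s = \<phi>2 s}"
    have "subgroup ?D S"
      by (rule S.subgroupI) auto
    moreover have "closedin T ?D"
      using closedin_continuous_maps_eq[OF hU 1(3) 2(3)] by (simp add: top)
    moreover have "x i \<in> ?D" for i
      using xS 1(4) 2(4) by simp
    ultimately have "carrier S \<subseteq> ?D"
      by (rule gen)
    then show ?thesis
      using 1(2) 2(2) by (intro extensionalityI[of _ "carrier S"]) auto
  qed
  ultimately show ?thesis
    by (intro ex_ex1I) blast+
qed


section \<open>The Zassenhaus filtration and canonical decompositions\<close>

definition commutator :: "'a monoid \<Rightarrow> 'a \<Rightarrow> 'a \<Rightarrow> 'a" where
  "commutator G x y = inv\<^bsub>G\<^esub> x \<otimes>\<^bsub>G\<^esub> inv\<^bsub>G\<^esub> y \<otimes>\<^bsub>G\<^esub> x \<otimes>\<^bsub>G\<^esub> y"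

lemma ceiling_div_less:
  fixes m p :: nat
  assumes "\<not> (m \<le> 1 \<or> p \<le> 1)"
  shows "(m + p - Suc 0) div p < m"
proof -
  have "m \<ge> 2" "p \<ge> 2"
    using assms by auto
  then have "m + p \<le> m * p"
    by (induction m rule: dec_induct) auto
  then have "m + p - Suc 0 < m * p"
    using \<open>m \<ge> 2\<close> by linarith
  then show ?thesis
    by (simp add: less_mult_imp_div_less)
qed

text \<open>Here \<open>(m + p - 1) div p\<close> is the ceiling of \<open>m / p\<close>.  The powers and commutators of closed
  subgroups, and the product of the resulting closed normal subgroups, are taken in the sense of
  topological groups, i.e. as closed subgroups.\<close>

function zassenhaus :: "nat \<Rightarrow> 'a monoid \<Rightarrow> 'a topology \<Rightarrow> nat \<Rightarrow> 'a set" where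
  "zassenhaus p G T m =
     (if m \<le> 1 \<or> p \<le> 1 then carrier G
      else closed_subgroup_generated G T
        ({g [^]\<^bsub>G\<^esub> p | g. g \<in> zassenhaus p G T ((m + p - 1) div p)}
         \<union> (\<Union>a\<in>{1..<m}. {commutator G g h | g h.
               g \<in> zassenhaus p G T a \<and> h \<in> zassenhaus p G T (m - a)})))"
  by auto
termination
  by (relation "measure (\<lambda>(p, G, T, m). m)") (auto intro: ceiling_div_less)

declare zassenhaus.simps [simp del]

text \<open>\<open>is_ordered_prod S T L f g\<close> says that \<open>g\<close> is the (possibly infinite) product of the
  factors \<open>f\<close>, as the limit of finite products over growing finite subsets \<open>F\<close> of the index set;
  \<open>L F\<close> lists the factors belonging to \<open>F\<close> in the prescribed order.\<close>

definition is_ordered_prod ::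
    "'a monoid \<Rightarrow> 'a topology \<Rightarrow> ('i set \<Rightarrow> 'j list) \<Rightarrow> ('j \<Rightarrow> 'a) \<Rightarrow> 'a \<Rightarrow> bool" where
  "is_ordered_prod S T L f g \<longleftrightarrow>
     limitin T (\<lambda>F. foldr (\<lambda>j z. f j \<otimes>\<^bsub>S\<^esub> z) (L F) \<one>\<^bsub>S\<^esub>) g finite_sets_at_top"

definition singles :: "'i::wellorder set \<Rightarrow> 'i list" where
  "singles F = sorted_list_of_set F"

definition pairs :: "'i::wellorder set \<Rightarrow> ('i \<times> 'i) list" where
  "pairs F = [(i, j). i \<leftarrow> sorted_list_of_set F, j \<leftarrow> sorted_list_of_set F, i < j]"

definition triples :: "'i::wellorder set \<Rightarrow> ('i \<times> 'i \<times> 'i) list" where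
  "triples F = [(i, j, k). i \<leftarrow> sorted_list_of_set F, j \<leftarrow> sorted_list_of_set F,
                  k \<leftarrow> sorted_list_of_set F, i < j \<and> k \<le> j]"

text \<open>The exponents \<open>a i\<close> are irrelevant for \<open>p > 3\<close>, and \<open>b i j\<close>, \<open>c i j k\<close> are only relevant
  for \<open>i < j\<close>, \<open>k \<le> j\<close>.  The lexicographic order of the factors is one choice of a fixed order;
  the exponents do not depend on it, as the quotient of the second by the fourth term of the
  filtration is abelian.\<close>

definition canonical_decomposition ::
    "nat \<Rightarrow> 'a monoid \<Rightarrow> 'a topology \<Rightarrow> ('i::wellorder \<Rightarrow> 'a) \<Rightarrow> 'a \<Rightarrow>
     ('i \<Rightarrow> nat) \<Rightarrow> ('i \<Rightarrow> 'i \<Rightarrow> nat) \<Rightarrow> ('i \<Rightarrow> 'i \<Rightarrow> 'i \<Rightarrow> nat) \<Rightarrow> bool" where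
  "canonical_decomposition p S T x r a b c \<longleftrightarrow>
     (\<forall>i. a i < p) \<and> (\<forall>i j. i < j \<longrightarrow> b i j < p) \<and> (\<forall>i j k. i < j \<and> k \<le> j \<longrightarrow> c i j k < p) \<and>
     (\<exists>A B C r'.
        is_ordered_prod S T singles (\<lambda>i. x i [^]\<^bsub>S\<^esub> (p * a i)) A \<and>
        is_ordered_prod S T pairs (\<lambda>(i, j). commutator S (x i) (x j) [^]\<^bsub>S\<^esub> b i j) B \<and>
        is_ordered_prod S T triples
          (\<lambda>(i, j, k). commutator S (commutator S (x i) (x j)) (x k) [^]\<^bsub>S\<^esub> c i j k) C \<and>
        r' \<in> zassenhaus p S T 4 \<and>
        r = (if p = 2 then A \<otimes>\<^bsub>S\<^esub> B \<otimes>\<^bsub>S\<^esub> C \<otimes>\<^bsub>S\<^esub> r'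
             else if p = 3 then B \<otimes>\<^bsub>S\<^esub> A \<otimes>\<^bsub>S\<^esub> C \<otimes>\<^bsub>S\<^esub> r'
             else B \<otimes>\<^bsub>S\<^esub> C \<otimes>\<^bsub>S\<^esub> r'))"

definition u_exponent :: "('i::wellorder \<Rightarrow> 'i \<Rightarrow> nat) \<Rightarrow> 'i \<Rightarrow> 'i \<Rightarrow> nat" where
  "u_exponent b i j = (if i < j then b i j else b j i)"


section \<open>Continuous cochains with coefficients in the field with p elements\<close>

text \<open>The coefficient field is \<open>{0..<p}\<close> with arithmetic modulo \<open>p\<close>, discrete topology and trivial
  action.  An \<open>n\<close>-cochain is a continuous function on \<open>n\<close>-tuples, which are extensional functions
  on \<open>{..<n}\<close>.\<close>

abbreviation tuples :: "'g monoid \<Rightarrow> nat \<Rightarrow> (nat \<Rightarrow> 'g) set" where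
  "tuples G n \<equiv> {..<n} \<rightarrow>\<^sub>E carrier G"

definition cochains ::
    "nat \<Rightarrow> 'g monoid \<Rightarrow> 'g topology \<Rightarrow> nat \<Rightarrow> ((nat \<Rightarrow> 'g) \<Rightarrow> int) monoid" where
  "cochains p G T n =
     \<lparr>carrier = {f \<in> extensional (tuples G n).
        continuous_map (product_topology (\<lambda>_. T) {..<n}) (discrete_topology {0..<int p}) f},
      monoid.mult = (\<lambda>f h. \<lambda>g\<in>tuples G n. (f g + h g) mod int p),
      one = (\<lambda>g\<in>tuples G n. 0)\<rparr>"

text \<open>\<open>face G n i\<close> maps an \<open>(n + 1)\<close>-tuple to an \<open>n\<close>-tuple: it drops the first entry if \<open>i = 0\<close>,
  drops the last one if \<open>i = n + 1\<close>, and otherwise multiplies the \<open>i\<close>-th with the next entry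
  (counting from 1).\<close>

definition face :: "'g monoid \<Rightarrow> nat \<Rightarrow> nat \<Rightarrow> (nat \<Rightarrow> 'g) \<Rightarrow> (nat \<Rightarrow> 'g)" where
  "face G n i g = (\<lambda>k\<in>{..<n}. if k + 1 < i then g k
                              else if k + 1 = i then g k \<otimes>\<^bsub>G\<^esub> g (k + 1)
                              else g (k + 1))"

definition coboundary ::
    "nat \<Rightarrow> 'g monoid \<Rightarrow> nat \<Rightarrow> ((nat \<Rightarrow> 'g) \<Rightarrow> int) \<Rightarrow> ((nat \<Rightarrow> 'g) \<Rightarrow> int)" where
  "coboundary p G n f =
     (\<lambda>g\<in>tuples G (n + 1). (\<Sum>i\<le>n + 1. (- 1) ^ i * f (face G n i g)) mod int p)"

definition cup ::
    "nat \<Rightarrow> 'g monoid \<Rightarrow> nat \<Rightarrow> nat \<Rightarrow> ((nat \<Rightarrow> 'g) \<Rightarrow> int) \<Rightarrow> ((nat \<Rightarrow> 'g) \<Rightarrow> int)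
       \<Rightarrow> ((nat \<Rightarrow> 'g) \<Rightarrow> int)" where
  "cup p G m n f h =
     (\<lambda>g\<in>tuples G (m + n). (f (\<lambda>k\<in>{..<m}. g k) * h (\<lambda>k\<in>{..<n}. g (m + k))) mod int p)"

definition cocycles ::
    "nat \<Rightarrow> 'g monoid \<Rightarrow> 'g topology \<Rightarrow> nat \<Rightarrow> ((nat \<Rightarrow> 'g) \<Rightarrow> int) monoid" where
  "cocycles p G T n = (cochains p G T n)
     \<lparr>carrier := {f \<in> carrier (cochains p G T n). coboundary p G n f = \<one>\<^bsub>cochains p G T (n + 1)\<^esub>}\<rparr>"

definition coboundaries ::
    "nat \<Rightarrow> 'g monoid \<Rightarrow> 'g topology \<Rightarrow> nat \<Rightarrow> ((nat \<Rightarrow> 'g) \<Rightarrow> int) set" where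
  "coboundaries p G T n = (case n of
     0 \<Rightarrow> {\<one>\<^bsub>cochains p G T 0\<^esub>}
   | Suc m \<Rightarrow> coboundary p G m ` carrier (cochains p G T m))"

definition cohomology ::
    "nat \<Rightarrow> 'g monoid \<Rightarrow> 'g topology \<Rightarrow> nat \<Rightarrow> ((nat \<Rightarrow> 'g) \<Rightarrow> int) set monoid" where
  "cohomology p G T n = cocycles p G T n Mod coboundaries p G T n"

definition cohomology_class ::
    "nat \<Rightarrow> 'g monoid \<Rightarrow> 'g topology \<Rightarrow> nat \<Rightarrow> ((nat \<Rightarrow> 'g) \<Rightarrow> int) \<Rightarrow> ((nat \<Rightarrow> 'g) \<Rightarrow> int) set" where
  "cohomology_class p G T n f = coboundaries p G T n #>\<^bsub>cocycles p G T n\<^esub> f"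


section \<open>Triple Massey products\<close>

definition massey_defining_system where
  "massey_defining_system p G T \<alpha>1 \<alpha>2 \<alpha>3 a12 a23 a34 a13 a24 \<longleftrightarrow>
     {a12, a23, a34} \<subseteq> carrier (cocycles p G T 1) \<and> {a13, a24} \<subseteq> carrier (cochains p G T 1) \<and>
     cohomology_class p G T 1 a12 = \<alpha>1 \<and>
     cohomology_class p G T 1 a23 = \<alpha>2 \<and>
     cohomology_class p G T 1 a34 = \<alpha>3 \<and>
     coboundary p G 1 a13 = cup p G 1 1 a12 a23 \<and>
     coboundary p G 1 a24 = cup p G 1 1 a23 a34"

definition triple_massey_product where
  "triple_massey_product p G T \<alpha>1 \<alpha>2 \<alpha>3 =
     {cohomology_class p G T 2 (cup p G 1 1 a12 a24 \<otimes>\<^bsub>cochains p G T 2\<^esub> cup p G 1 1 a13 a34)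
      | a12 a23 a34 a13 a24. massey_defining_system p G T \<alpha>1 \<alpha>2 \<alpha>3 a12 a23 a34 a13 a24}"

definition vanishing_triple_massey :: "nat \<Rightarrow> 'g monoid \<Rightarrow> 'g topology \<Rightarrow> bool" where
  "vanishing_triple_massey p G T \<longleftrightarrow>
     (\<forall>\<alpha>1\<in>carrier (cohomology p G T 1). \<forall>\<alpha>2\<in>carrier (cohomology p G T 1).
        \<forall>\<alpha>3\<in>carrier (cohomology p G T 1).
        triple_massey_product p G T \<alpha>1 \<alpha>2 \<alpha>3 \<noteq> {} \<longrightarrow>
        \<one>\<^bsub>cohomology p G T 2\<^esub> \<in> triple_massey_product p G T \<alpha>1 \<alpha>2 \<alpha>3)"

end

theory Submission
  imports Defs "HOL-Number_Theory.Cong"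
begin

text \<open>Triple Massey products are obstructions to lifting unitriangular representations: if they
  vanish for \<open>G\<close>, then the first superdiagonal of every continuous homomorphism from \<open>G\<close> to the
  group of unitriangular \<open>4 \<times> 4\<close> matrices modulo its centre is also the first superdiagonal of a
  continuous homomorphism to the full group \<open>U\<close> of unitriangular matrices over the field with \<open>p\<close>
  elements.

  Let \<open>S \<rightarrow> U\<close> map \<open>x\<^sub>k\<close>, \<open>x\<^sub>i\<close>, \<open>x\<^sub>j\<close> to the elementary matrices with entry 1 at the places
  \<open>(1,2)\<close>, \<open>(2,3)\<close>, \<open>(3,4)\<close> and all other basis elements to 1.  The hypotheses on \<open>[x\<^sub>k, x\<^sub>i]\<close> and
  \<open>[x\<^sub>i, x\<^sub>j]\<close> say that \<open>R\<close> goes to the centre, so \<open>G\<close> is represented modulo the centre.  A lift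
  to \<open>U\<close> with the same first superdiagonal would kill \<open>r\<close>.  But whatever the remaining entries of
  the lift are, the fourth term of the Zassenhaus filtration acts trivially, the hypotheses on \<open>r\<close>
  make the powers and simple commutators contribute nothing to the \<open>(1,4)\<close> entry of the image
  of \<open>r\<close>, and among the triple commutators only \<open>[[x\<^sub>i, x\<^sub>j], x\<^sub>k]\<close> contributes.  Hence this
  entry is \<open>- c\<^sub>i\<^sub>j\<^sub>k \<noteq> 0\<close>.\<close>

section \<open>Unitriangular representations\<close>

text \<open>The entries are integers that multiply like matrix entries only modulo \<open>p\<close>.
  Congruences can then be passed to \<open>algebra\<close> as integer identities, and later entries
  such as \<open>- u13 g\<close> need no reduction.\<close>

locale unitriangular_rep = group G for G :: "'a monoid" (structure) +
  fixes p :: nat and e12 e23 e34 e13 e24 e14 :: "'a \<Rightarrow> int"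
  assumes mult12: "\<lbrakk>g \<in> carrier G; h \<in> carrier G\<rbrakk> \<Longrightarrow> [e12 (g \<otimes> h) = e12 g + e12 h] (mod int p)"
    and mult23: "\<lbrakk>g \<in> carrier G; h \<in> carrier G\<rbrakk> \<Longrightarrow> [e23 (g \<otimes> h) = e23 g + e23 h] (mod int p)"
    and mult34: "\<lbrakk>g \<in> carrier G; h \<in> carrier G\<rbrakk> \<Longrightarrow> [e34 (g \<otimes> h) = e34 g + e34 h] (mod int p)"
    and mult13: "\<lbrakk>g \<in> carrier G; h \<in> carrier G\<rbrakk> \<Longrightarrow>
      [e13 (g \<otimes> h) = e13 g + e13 h + e12 g * e23 h] (mod int p)"
    and mult24: "\<lbrakk>g \<in> carrier G; h \<in> carrier G\<rbrakk> \<Longrightarrow>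
      [e24 (g \<otimes> h) = e24 g + e24 h + e23 g * e34 h] (mod int p)"
    and mult14: "\<lbrakk>g \<in> carrier G; h \<in> carrier G\<rbrakk> \<Longrightarrow>
      [e14 (g \<otimes> h) = e14 g + e14 h + e12 g * e24 h + e13 g * e34 h] (mod int p)"
begin

lemmas mult = mult12 mult23 mult34 mult13 mult24 mult14

section \<open>Entries of the identity, of commutators, powers and inverses\<close>

lemma entries_one:
  "[e12 \<one> = 0] (mod int p)" "[e23 \<one> = 0] (mod int p)" "[e34 \<one> = 0] (mod int p)"
  "[e13 \<one> = 0] (mod int p)" "[e24 \<one> = 0] (mod int p)" "[e14 \<one> = 0] (mod int p)"
proof -
  show 1: "[e12 \<one> = 0] (mod int p)" "[e23 \<one> = 0] (mod int p)" "[e34 \<one> = 0] (mod int p)"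
    using mult12[of \<one> \<one>] mult23[of \<one> \<one>] mult34[of \<one> \<one>]
    by (simp_all add: cong_iff_dvd_diff)
  have "[0 = e13 \<one> + e12 \<one> * e23 \<one>] (mod int p)"
    "[0 = e24 \<one> + e23 \<one> * e34 \<one>] (mod int p)"
    "[0 = e14 \<one> + e12 \<one> * e24 \<one> + e13 \<one> * e34 \<one>] (mod int p)"
    using mult13[of \<one> \<one>] mult24[of \<one> \<one>] mult14[of \<one> \<one>]
    by (simp_all add: cong_iff_dvd_diff algebra_simps)
  with 1 show "[e13 \<one> = 0] (mod int p)" "[e24 \<one> = 0] (mod int p)" "[e14 \<one> = 0] (mod int p)"
    by (simp_all add: cong_sym_eq[of 0] cong_0_iff dvd_add_left_iff)
qed

lemma commutator_closed: "\<lbrakk>g \<in> carrier G; h \<in> carrier G\<rbrakk> \<Longrightarrow> commutator G g h \<in> carrier G"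
  by (simp add: commutator_def)

text \<open>The commutator \<open>c\<close> is determined by
  \<open>h \<otimes> g \<otimes> c = g \<otimes> h\<close>. Comparing both sides one superdiagonal
  after the other gives its entries without inverting a matrix.\<close>

lemma entries_commutator:
  assumes g: "g \<in> carrier G" and h: "h \<in> carrier G"
  shows "[e12 (commutator G g h) = 0] (mod int p)" "[e23 (commutator G g h) = 0] (mod int p)"
    "[e34 (commutator G g h) = 0] (mod int p)"
    "[e13 (commutator G g h) = e12 g * e23 h - e12 h * e23 g] (mod int p)"
    "[e24 (commutator G g h) = e23 g * e34 h - e23 h * e34 g] (mod int p)"
    "[e14 (commutator G g h) = e12 g * e24 h + e13 g * e34 h - e12 h * e24 g - e13 h * e34 g
        - (e12 g + e12 h) * (e23 g * e34 h - e23 h * e34 g)] (mod int p)"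
proof -
  define c where "c = commutator G g h"
  have c: "c \<in> carrier G"
    using g h by (simp add: c_def commutator_def)
  have gh: "g \<otimes> h \<in> carrier G" and hg: "h \<otimes> g \<in> carrier G"
    using g h by auto
  have eq: "h \<otimes> g \<otimes> c = g \<otimes> h"
  proof -
    have "u \<otimes> (inv u \<otimes> z) = z" if "u \<in> carrier G" "z \<in> carrier G" for u z
      using that by (simp add: m_assoc[symmetric])
    then show ?thesis
      using g h by (simp add: c_def commutator_def m_assoc)
  qed
  show 1: "[e12 (commutator G g h) = 0] (mod int p)" "[e23 (commutator G g h) = 0] (mod int p)"
    "[e34 (commutator G g h) = 0] (mod int p)"
    using mult12[OF g h] mult12[OF h g] mult12[OF hg c, unfolded eq]
      mult23[OF g h] mult23[OF h g] mult23[OF hg c, unfolded eq]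
      mult34[OF g h] mult34[OF h g] mult34[OF hg c, unfolded eq]
    unfolding c_def[symmetric] cong_iff_dvd_diff dvd_def by algebra+
  show "[e13 (commutator G g h) = e12 g * e23 h - e12 h * e23 g] (mod int p)"
    using mult13[OF g h] mult13[OF h g] mult13[OF hg c, unfolded eq] 1
    unfolding c_def[symmetric] cong_iff_dvd_diff dvd_def by algebra
  show 2: "[e24 (commutator G g h) = e23 g * e34 h - e23 h * e34 g] (mod int p)"
    using mult24[OF g h] mult24[OF h g] mult24[OF hg c, unfolded eq] 1
    unfolding c_def[symmetric] cong_iff_dvd_diff dvd_def by algebra
  show "[e14 (commutator G g h) = e12 g * e24 h + e13 g * e34 h - e12 h * e24 g - e13 h * e34 g
        - (e12 g + e12 h) * (e23 g * e34 h - e23 h * e34 g)] (mod int p)"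
    using mult14[OF g h] mult14[OF h g] mult14[OF hg c, unfolded eq] 1 2 mult12[OF h g]
    unfolding c_def[symmetric] cong_iff_dvd_diff dvd_def by algebra
qed

text \<open>Write the matrix as \<open>1 + X\<close> with \<open>X\<close> strictly upper
  triangular. Since \<open>X^4 = 0\<close>, the binomial expansion of the power stops at the cubic
  term; the induction step is Pascal's rule.\<close>

lemma entries_pow:
  assumes g: "g \<in> carrier G"
  shows "[e12 (g [^] n) = int n * e12 g] (mod int p)"
    "[e23 (g [^] n) = int n * e23 g] (mod int p)"
    "[e34 (g [^] n) = int n * e34 g] (mod int p)"
    "[e13 (g [^] n) = int n * e13 g + int (n choose 2) * (e12 g * e23 g)] (mod int p)"
    "[e24 (g [^] n) = int n * e24 g + int (n choose 2) * (e23 g * e34 g)] (mod int p)"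
    "[e14 (g [^] n) = int n * e14 g + int (n choose 2) * (e12 g * e24 g + e13 g * e34 g)
        + int (n choose 3) * (e12 g * e23 g * e34 g)] (mod int p)"
proof (induction n)
  case 0
  case 1 show ?case by (simp add: entries_one)
  case 2 show ?case by (simp add: entries_one)
  case 3 show ?case by (simp add: entries_one)
  case 4 show ?case by (simp add: entries_one binomial_eq_0)
  case 5 show ?case by (simp add: entries_one binomial_eq_0)
  case 6 show ?case by (simp add: entries_one binomial_eq_0)
next
  case (Suc n)
  have gn: "g [^] n \<in> carrier G"
    using g by simp
  have choose: "int (Suc n choose 2) = int n + int (n choose 2)"
    "int (Suc n choose 3) = int (n choose 2) + int (n choose 3)" "int (Suc n) = int n + 1"
    by (simp_all add: numeral_2_eq_2 numeral_3_eq_3)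
  note m = mult[OF gn g]
  case 1 show ?case
    using m(1) Suc.IH(1) unfolding nat_pow_Suc choose cong_iff_dvd_diff dvd_def by algebra
  case 2 show ?case
    using m(2) Suc.IH(2) unfolding nat_pow_Suc choose cong_iff_dvd_diff dvd_def by algebra
  case 3 show ?case
    using m(3) Suc.IH(3) unfolding nat_pow_Suc choose cong_iff_dvd_diff dvd_def by algebra
  case 4 show ?case
    using m(4) Suc.IH(1,4) unfolding nat_pow_Suc choose cong_iff_dvd_diff dvd_def by algebra
  case 5 show ?case
    using m(5) Suc.IH(2,5) unfolding nat_pow_Suc choose cong_iff_dvd_diff dvd_def by algebra
  case 6 show ?case
    using m(6) Suc.IH(1,4,6) unfolding nat_pow_Suc choose cong_iff_dvd_diff dvd_def by algebra
qed

text \<open>With the matrix written as \<open>1 + X\<close>, these are the entries of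
  \<open>1 - X + X^2 - X^3\<close>.\<close>

lemma entries_inv:
  assumes g: "g \<in> carrier G"
  shows "[e12 (inv g) = - e12 g] (mod int p)" "[e23 (inv g) = - e23 g] (mod int p)"
    "[e34 (inv g) = - e34 g] (mod int p)"
    "[e13 (inv g) = e12 g * e23 g - e13 g] (mod int p)"
    "[e24 (inv g) = e23 g * e34 g - e24 g] (mod int p)"
    "[e14 (inv g) = e12 g * e24 g + e13 g * e34 g - e12 g * e23 g * e34 g - e14 g] (mod int p)"
proof -
  note m = mult[OF g inv_closed[OF g], unfolded r_inv[OF g]]
  show 1: "[e12 (inv g) = - e12 g] (mod int p)" "[e23 (inv g) = - e23 g] (mod int p)"
    "[e34 (inv g) = - e34 g] (mod int p)"
    using m(1-3) entries_one(1-3) unfolding cong_iff_dvd_diff dvd_def by algebra+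
  show 2: "[e13 (inv g) = e12 g * e23 g - e13 g] (mod int p)"
    using m(4) entries_one(4) 1 unfolding cong_iff_dvd_diff dvd_def by algebra
  show 3: "[e24 (inv g) = e23 g * e34 g - e24 g] (mod int p)"
    using m(5) entries_one(5) 1 unfolding cong_iff_dvd_diff dvd_def by algebra
  show "[e14 (inv g) = e12 g * e24 g + e13 g * e34 g - e12 g * e23 g * e34 g - e14 g] (mod int p)"
    using m(6) entries_one(6) 1(3) 3 unfolding cong_iff_dvd_diff dvd_def by algebra
qed

text \<open>For \<open>m\<close> from 1 to 4 this is the preimage of the \<open>m\<close>-th term of
  the lower central series of the unitriangular matrices: everything for \<open>m \<le> 1\<close>,
  the kernel of the representation from \<open>m = 4\<close> on.\<close>

definition level :: "nat \<Rightarrow> 'a set" where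
  "level m = {g \<in> carrier G.
     (2 \<le> m \<longrightarrow> [e12 g = 0] (mod int p) \<and> [e23 g = 0] (mod int p) \<and> [e34 g = 0] (mod int p))
     \<and> (3 \<le> m \<longrightarrow> [e13 g = 0] (mod int p) \<and> [e24 g = 0] (mod int p))
     \<and> (4 \<le> m \<longrightarrow> [e14 g = 0] (mod int p))}"

lemma level_antimono: "m \<le> n \<Longrightarrow> level n \<subseteq> level m"
  by (auto simp: level_def)

lemma subgroup_level: "subgroup (level m) G"
proof (rule subgroupI)
  show "level m \<subseteq> carrier G"
    by (auto simp: level_def)
  have "\<one> \<in> level m"
    by (simp add: level_def entries_one)
  then show "level m \<noteq> {}"
    by blast
next
  fix g assume g: "g \<in> level m"
  then have gG: "g \<in> carrier G"
    by (simp add: level_def)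
  show "inv g \<in> level m"
    using g entries_inv[OF gG] by (auto simp: level_def cong_0_iff cong_dvd_iff)
next
  fix g h assume g: "g \<in> level m" and h: "h \<in> level m"
  then have gG: "g \<in> carrier G" and hG: "h \<in> carrier G"
    by (simp_all add: level_def)
  show "g \<otimes> h \<in> level m"
    using g h mult[OF gG hG] by (auto simp: level_def cong_0_iff cong_dvd_iff)
qed

text \<open>Both cross terms in the rule for \<open>e14\<close> contain an entry of the first
  superdiagonal, which vanishes on \<open>level 2\<close>. Hence the contributions of the factors of
  \<open>r\<close> to the corner entry simply add up.\<close>

lemma e14_mult_level2:
  assumes "g \<in> level 2" "h \<in> level 2"
  shows "[e14 (g \<otimes> h) = e14 g + e14 h] (mod int p)"
proof -
  have "[e12 g = 0] (mod int p)" "[e34 h = 0] (mod int p)" "g \<in> carrier G" "h \<in> carrier G"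
    using assms by (auto simp: level_def)
  with mult14[of g h] show ?thesis
    unfolding cong_iff_dvd_diff dvd_def by algebra
qed

text \<open>This subgroup collects the factors of a canonical decomposition that contribute nothing
  to the corner entry. For continuous entries it is also closed and so contains their infinite
  products.\<close>

lemma subgroup_level2_e14: "subgroup {g \<in> level 2. [e14 g = 0] (mod int p)} G"
proof (rule subgroupI)
  show "{g \<in> level 2. [e14 g = 0] (mod int p)} \<subseteq> carrier G"
    by (auto simp: level_def)
  have "\<one> \<in> {g \<in> level 2. [e14 g = 0] (mod int p)}"
    by (simp add: level_def entries_one)
  then show "{g \<in> level 2. [e14 g = 0] (mod int p)} \<noteq> {}"
    by blast
next
  fix g assume g: "g \<in> {g \<in> level 2. [e14 g = 0] (mod int p)}"
  then have gG: "g \<in> carrier G"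
    by (simp add: level_def)
  show "inv g \<in> {g \<in> level 2. [e14 g = 0] (mod int p)}"
    using g entries_inv[OF gG] by (auto simp: level_def cong_0_iff cong_dvd_iff)
next
  fix g h
  assume gh: "g \<in> {g \<in> level 2. [e14 g = 0] (mod int p)}" "h \<in> {g \<in> level 2. [e14 g = 0] (mod int p)}"
  then have "g \<otimes> h \<in> level 2"
    using subgroup.m_closed[OF subgroup_level] by simp
  then show "g \<otimes> h \<in> {g \<in> level 2. [e14 g = 0] (mod int p)}"
    using gh e14_mult_level2[of g h] by (auto simp: cong_0_iff cong_dvd_iff)
qed

text \<open>Distances from the diagonal add under commutators. Since \<open>a + b\<close> is at most
  4, only six pairs occur, and each is read off from \<open>entries_commutator\<close>.\<close>

lemma commutator_level:
  assumes g: "g \<in> level a" and h: "h \<in> level b" and ab: "0 < a" "0 < b" "a + b \<le> 4"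
  shows "commutator G g h \<in> level (a + b)"
proof -
  have gG: "g \<in> carrier G" and hG: "h \<in> carrier G"
    using g h by (simp_all add: level_def)
  note c = entries_commutator[OF gG hG]
  consider "a = 1" "b = 1" | "a = 1" "b = 2" | "a = 2" "b = 1"
    | "a = 1" "b = 3" | "a = 2" "b = 2" | "a = 3" "b = 1"
    using ab by linarith
  then show ?thesis
    using g h c commutator_closed[OF gG hG]
    by cases (simp_all add: level_def cong_0_iff cong_dvd_iff)
qed

text \<open>In the binomial expansion \<open>p\<close> divides the linear coefficient, and also
  \<open>p choose 2\<close> unless \<open>p = 2\<close> and \<open>p choose 3\<close> unless
  \<open>p = 3\<close>. In these exceptional cases the nonlinear terms vanish because each contains
  a first-superdiagonal entry of an element of \<open>level 2\<close>.\<close>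

lemma pow_prime_level:
  assumes p: "prime p" and g: "g \<in> level q"
    and q: "p = 2 \<and> 3 \<le> m \<or> p = 3 \<and> 4 \<le> m \<Longrightarrow> 2 \<le> q"
  shows "g [^] p \<in> level m"
proof -
  have gG: "g \<in> carrier G"
    using g by (simp add: level_def)
  note c = entries_pow[OF gG, of p]
  have p2: "int p dvd int (p choose 2)" if "p \<noteq> 2"
    using dvd_choose_prime[of 2 p] prime_ge_2_nat[OF p] p that by auto
  have p3: "int p dvd int (p choose 3)" if "p \<noteq> 3"
  proof (cases "p = 2")
    case False
    then show ?thesis
      using dvd_choose_prime[of 3 p] prime_ge_2_nat[OF p] p that by auto
  qed (simp add: binomial_eq_0)
  have "int p dvd int (p choose 2) \<or> 2 \<le> q" if "3 \<le> m"
    using p2 q that by blast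
  moreover have "int p dvd int (p choose 3) \<or> 2 \<le> q" if "4 \<le> m"
    using p3 q that by blast
  ultimately show ?thesis
    using g c gG by (cases "2 \<le> q") (auto simp: level_def cong_0_iff cong_dvd_iff)
qed

end

section \<open>Continuous representations and the Zassenhaus filtration\<close>

locale continuous_unitriangular_rep = unitriangular_rep G p e12 e23 e34 e13 e24 e14
  for G :: "'a monoid" (structure) and p e12 e23 e34 e13 e24 e14 +
  fixes T :: "'a topology"
  assumes top: "topspace T = carrier G"
    and cont12: "continuous_map T (discrete_topology UNIV) e12"
    and cont23: "continuous_map T (discrete_topology UNIV) e23"
    and cont34: "continuous_map T (discrete_topology UNIV) e34"
    and cont13: "continuous_map T (discrete_topology UNIV) e13"
    and cont24: "continuous_map T (discrete_topology UNIV) e24"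
    and cont14: "continuous_map T (discrete_topology UNIV) e14"
begin

lemma closedin_cong:
  assumes "continuous_map T (discrete_topology UNIV) e"
  shows "closedin T {g \<in> carrier G. [e g = v] (mod int p)}"
  using closedin_continuous_map_preimage[OF assms, of "{z. [z = v] (mod int p)}"] by (simp add: top)

lemma closedin_level: "closedin T (level m)"
proof -
  have conj: "closedin T {g \<in> carrier G. P g \<and> Q g}"
    if "closedin T {g \<in> carrier G. P g}" "closedin T {g \<in> carrier G. Q g}" for P Q
    using closedin_Int[OF that] by (rule back_subst[of "closedin T"]) auto
  have imp: "closedin T {g \<in> carrier G. B \<longrightarrow> P g}" if "closedin T {g \<in> carrier G. P g}" for B P
    using that closedin_topspace[of T] by (cases B) (simp_all add: top)
  show ?thesis
    unfolding level_def
    by (intro conj imp closedin_cong cont12 cont23 cont34 cont13 cont24 cont14)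
qed

lemma closedin_level_e14: "closedin T {g \<in> level m. [e14 g = v] (mod int p)}"
  using closedin_Int[OF closedin_level closedin_cong[OF cont14, of v]]
  by (rule back_subst[of "closedin T"]) (auto simp: level_def)

text \<open>The levels are closed subgroups and contain the powers and commutators that generate the
  filtration. The case \<open>m = 4\<close> makes the remainder \<open>r'\<close> of a canonical
  decomposition act trivially.\<close>

lemma zassenhaus_subset_level:
  assumes p: "prime p"
  shows "m \<le> 4 \<Longrightarrow> zassenhaus p G T m \<subseteq> level m"
proof (induction m rule: less_induct)
  case (less m)
  show ?case
  proof (cases "m \<le> 1")
    case True
    then show ?thesis
      by (auto simp: zassenhaus.simps[of _ _ _ m] level_def)
  next
    case False
    have p2: "2 \<le> p"
      using p by (rule prime_ge_2_nat)
    define q where "q = (m + p - 1) div p"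
    have "q < m"
      using ceiling_div_less[of m p] False p2 by (simp add: q_def)
    with less have q: "zassenhaus p G T q \<subseteq> level q"
      by simp
    \<comment> \<open>In exactly these cases the binomial coefficients do not help, but there the
      ceiling of \<open>m / p\<close> is already at least 2.\<close>
    have q2: "2 \<le> q" if "p = 2 \<and> 3 \<le> m \<or> p = 3 \<and> 4 \<le> m"
      using that by (auto simp: q_def)
    have "g [^] p \<in> level m" if "g \<in> zassenhaus p G T q" for g
      using q that q2 by (intro pow_prime_level[OF p]) auto
    moreover have "commutator G g h \<in> level m"
      if "a \<in> {1..<m}" "g \<in> zassenhaus p G T a" "h \<in> zassenhaus p G T (m - a)" for a g h
    proof -
      have "m - a \<le> 4" "a \<le> 4"
        using that(1) less.prems by auto
      then have "g \<in> level a" "h \<in> level (m - a)"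
        using that less.IH[of a] less.IH[of "m - a"] less.prems by auto
      then show ?thesis
        using commutator_level[of g a h "m - a"] that(1) less.prems by auto
    qed
    ultimately show ?thesis
      unfolding zassenhaus.simps[of _ _ _ m] q_def closed_subgroup_generated_def
      using False p2 subgroup_level[of m] closedin_level[of m] by (auto intro!: Inter_lower)
  qed
qed

end

section \<open>Triple Massey products and lifting\<close>

definition cochain1 :: "'g monoid \<Rightarrow> ('g \<Rightarrow> int) \<Rightarrow> (nat \<Rightarrow> 'g) \<Rightarrow> int" where
  "cochain1 G f = (\<lambda>t\<in>tuples G 1. f (t 0))"

lemma cochain1_in_cochains:
  assumes top: "topspace T = carrier G"
    and f: "continuous_map T (discrete_topology {0..<int p}) f"
  shows "cochain1 G f \<in> carrier (cochains p G T 1)"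
proof -
  have "continuous_map (product_topology (\<lambda>_. T) {..<1::nat}) T (\<lambda>t. t 0)"
    by (rule continuous_map_product_projection) simp
  from continuous_map_compose[OF this f]
  have "continuous_map (product_topology (\<lambda>_. T) {..<1::nat}) (discrete_topology {0..<int p}) (\<lambda>t. f (t 0))"
    by (simp add: o_def)
  then have "continuous_map (product_topology (\<lambda>_. T) {..<1::nat}) (discrete_topology {0..<int p}) (cochain1 G f)"
    by (rule continuous_map_eq) (simp add: cochain1_def top)
  then show ?thesis
    by (simp add: cochains_def cochain1_def)
qed

lemma tuple1_eta: "t \<in> tuples G 1 \<Longrightarrow> (\<lambda>k\<in>{..<1}. t 0) = t"
  by (rule ext) (auto simp: PiE_def extensional_def)

lemma cochains1_cases:
  assumes top: "topspace T = carrier G" and u: "u \<in> carrier (cochains p G T 1)"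
  obtains f where "continuous_map T (discrete_topology {0..<int p}) f" "u = cochain1 G f"
proof
  have cont: "continuous_map (product_topology (\<lambda>_. T) {..<1}) (discrete_topology {0..<int p}) u"
    and ext: "u \<in> extensional (tuples G 1)"
    using u by (auto simp: cochains_def)
  have "continuous_map T (product_topology (\<lambda>_. T) {..<1::nat}) (\<lambda>g. \<lambda>k\<in>{..<1}. g)"
    by (auto simp: continuous_map_componentwise)
  from continuous_map_compose[OF this cont]
  show "continuous_map T (discrete_topology {0..<int p}) (\<lambda>g. u (\<lambda>k\<in>{..<1}. g))"
    by (simp add: o_def)
  show "u = cochain1 G (\<lambda>g. u (\<lambda>k\<in>{..<1}. g))"
    unfolding cochain1_def
    by (rule extensionalityI[OF ext restrict_extensional]) (simp only: restrict_apply' tuple1_eta)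
qed

lemma coboundary_cochain1:
  assumes "group G"
  shows "coboundary p G 1 (cochain1 G f) =
    (\<lambda>t\<in>tuples G 2. (f (t 1) - f (t 0 \<otimes>\<^bsub>G\<^esub> t 1) + f (t 0)) mod int p)"
proof -
  interpret group G by fact
  have f: "cochain1 G f (face G 1 i t) = f (face G 1 i t 0)" if "t \<in> tuples G 2" for i t
  proof -
    have "face G 1 i t \<in> tuples G 1"
      using that by (auto simp: face_def PiE_def extensional_def Pi_def)
    then show ?thesis
      by (simp add: cochain1_def)
  qed
  have "(\<Sum>i\<le>2. (- 1) ^ i * cochain1 G f (face G 1 i t)) = f (t 1) - f (t 0 \<otimes>\<^bsub>G\<^esub> t 1) + f (t 0)"
    if "t \<in> tuples G 2" for t
  proof -
    have "{..2::nat} = {0, 1, 2}"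
      by auto
    then show ?thesis
      unfolding f[OF that] by (simp add: face_def)
  qed
  then show ?thesis
    unfolding coboundary_def one_add_one by (intro restrict_ext) simp
qed

lemma cup_cochain1:
  "cup p G 1 1 (cochain1 G f) (cochain1 G h) = (\<lambda>t\<in>tuples G 2. (f (t 0) * h (t 1)) mod int p)"
proof -
  have "cochain1 G f (\<lambda>k\<in>{..<1}. t k) = f (t 0)" "cochain1 G h (\<lambda>k\<in>{..<1}. t (1 + k)) = h (t 1)"
    if "t \<in> tuples G 2" for t
  proof -
    have "(\<lambda>k\<in>{..<1}. t k) \<in> tuples G 1" "(\<lambda>k\<in>{..<1}. t (1 + k)) \<in> tuples G 1"
      using that by (auto simp: PiE_def extensional_def Pi_def)
    then show "cochain1 G f (\<lambda>k\<in>{..<1}. t k) = f (t 0)"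
      "cochain1 G h (\<lambda>k\<in>{..<1}. t (1 + k)) = h (t 1)"
      by (simp_all add: cochain1_def)
  qed
  then show ?thesis
    unfolding cup_def one_add_one by (intro restrict_ext) simp
qed

text \<open>This turns the cochain equations of a defining system into congruences for pairs of
  group elements.\<close>

lemma restrict_tuples2_eq_iff:
  "(\<lambda>t\<in>tuples G 2. F (t 0) (t 1)) = (\<lambda>t\<in>tuples G 2. F' (t 0) (t 1)) \<longleftrightarrow>
     (\<forall>g\<in>carrier G. \<forall>h\<in>carrier G. F g h = F' g h)" (is "?l = ?r \<longleftrightarrow> _")
proof (intro iffI ballI)
  fix g h assume eq: "?l = ?r" and gh: "g \<in> carrier G" "h \<in> carrier G"
  let ?t = "\<lambda>k\<in>{..<2::nat}. if k = 0 then g else h"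
  have "?t \<in> tuples G 2"
    using gh by auto
  with fun_cong[OF eq, of ?t] show "F g h = F' g h"
    by simp
next
  assume "\<forall>g\<in>carrier G. \<forall>h\<in>carrier G. F g h = F' g h"
  then show "?l = ?r"
    by (intro restrict_ext) (auto simp: PiE_def Pi_def)
qed

text \<open>The action on the coefficients is trivial: both faces of a 1-tuple are the empty tuple,
  so the two values of a 0-cochain cancel.\<close>

lemma coboundaries1:
  assumes "0 < p"
  shows "coboundaries p G T 1 = {\<one>\<^bsub>cochains p G T 1\<^esub>}"
proof -
  have "coboundary p G 0 = (\<lambda>_. \<one>\<^bsub>cochains p G T 1\<^esub>)"
  proof
    have "face G 0 i t = (\<lambda>_. undefined)" for i t
      by (simp add: face_def restrict_def fun_eq_iff)
    then show "coboundary p G 0 f = \<one>\<^bsub>cochains p G T 1\<^esub>" for f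
      by (simp add: coboundary_def cochains_def)
  qed
  \<comment> \<open>Some 0-cochain must exist, as otherwise the image would be empty instead of a
    singleton.\<close>
  moreover have "(\<lambda>t\<in>tuples G 0. 0) \<in> carrier (cochains p G T 0)"
  proof -
    have "continuous_map (product_topology (\<lambda>_. T) {..<0::nat}) (discrete_topology {0..<int p}) (\<lambda>_. 0)"
      using assms by simp
    then have "continuous_map (product_topology (\<lambda>_. T) {..<0::nat}) (discrete_topology {0..<int p})
        (\<lambda>t\<in>tuples G 0. 0)"
      by (rule continuous_map_eq) simp
    then show ?thesis
      by (simp add: cochains_def)
  qed
  ultimately show ?thesis
    by (auto simp: coboundaries_def image_constant_conv simp del: PiE_empty_domain)
qed

text \<open>As degree 1 has only the zero coboundary, a class is a single cocycle. A defining system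
  thus has exactly the prescribed superdiagonal and not just one that agrees up to
  coboundaries.\<close>

lemma cohomology_class1:
  assumes p: "0 < p" and top: "topspace T = carrier G" and u: "u \<in> carrier (cochains p G T 1)"
  shows "cohomology_class p G T 1 u = {u}"
proof -
  have "continuous_map (product_topology (\<lambda>_. T) {..<1}) (discrete_topology {0..<int p}) u"
    using u by (simp add: cochains_def)
  from continuous_map_funspace[OF this] have "u t \<in> {0..<int p}" if "t \<in> tuples G 1" for t
    using that unfolding topspace_product_topology top topspace_discrete_topology
    by (rule funcset_mem)
  then have "(\<lambda>t\<in>tuples G 1. (0 + u t) mod int p) = (\<lambda>t\<in>tuples G 1. u t)"
    by (intro restrict_ext) auto
  also have "\<dots> = u"
    using u by (simp add: cochains_def extensional_restrict)
  finally have "(\<lambda>t\<in>tuples G 1. u t mod int p) = u"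
    by simp
  then show ?thesis
    unfolding cohomology_class_def coboundaries1[OF p]
    by (simp add: r_coset_def cocycles_def) (simp add: cochains_def cong: restrict_cong)
qed

lemma cochain1_in_cocycles_iff:
  assumes "group G" and top: "topspace T = carrier G"
    and f: "continuous_map T (discrete_topology {0..<int p}) f"
  shows "cochain1 G f \<in> carrier (cocycles p G T 1) \<longleftrightarrow>
    (\<forall>g\<in>carrier G. \<forall>h\<in>carrier G. [f (g \<otimes>\<^bsub>G\<^esub> h) = f g + f h] (mod int p))"
proof -
  have "[f h - f (g \<otimes>\<^bsub>G\<^esub> h) + f g = 0] (mod int p) \<longleftrightarrow> [f (g \<otimes>\<^bsub>G\<^esub> h) = f g + f h] (mod int p)" for g h
    by (subst (2) cong_sym_eq) (simp add: cong_iff_dvd_diff algebra_simps)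
  then show ?thesis
    using restrict_tuples2_eq_iff[of "\<lambda>g h. (f h - f (g \<otimes>\<^bsub>G\<^esub> h) + f g) mod int p" G "\<lambda>_ _. 0"]
      cochain1_in_cochains[OF top f]
    unfolding cocycles_def
    by (simp add: coboundary_cochain1[OF assms(1)] del: One_nat_def)
       (simp add: cochains_def cong_def del: One_nat_def)
qed

text \<open>The zero cochain is a coboundary, so \<open>v\<close> lies in its own coset, which is
  the set of coboundaries by \<open>cls\<close>. The range condition makes adding zero modulo
  \<open>p\<close> return \<open>v\<close> itself.\<close>

lemma mem_coboundaries2:
  assumes G: "group G" and p: "0 < p"
    and v: "v \<in> extensional (tuples G 2)" "\<And>t. t \<in> tuples G 2 \<Longrightarrow> v t \<in> {0..<int p}"
    and cls: "cohomology_class p G T 2 v = coboundaries p G T 2"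
    and top: "topspace T = carrier G"
  shows "v \<in> coboundaries p G T 2"
proof -
  have "continuous_map T (discrete_topology {0..<int p}) (\<lambda>_. 0)"
    using p by simp
  then have "cochain1 G (\<lambda>_. 0) \<in> carrier (cochains p G T 1)"
    by (rule cochain1_in_cochains[OF top])
  moreover have "coboundary p G 1 (cochain1 G (\<lambda>_. 0)) = (\<lambda>t\<in>tuples G 2. 0)"
    unfolding coboundary_cochain1[OF G] by simp
  ultimately have zero: "(\<lambda>t\<in>tuples G 2. 0) \<in> coboundaries p G T 2"
    unfolding coboundaries_def numeral_2_eq_2 by (simp add: image_iff) metis
  have "v = (\<lambda>t\<in>tuples G 2. v t)"
    using v(1) by (simp add: extensional_restrict)
  also have "\<dots> = (\<lambda>t\<in>tuples G 2. ((\<lambda>t\<in>tuples G 2. 0) t + v t) mod int p)"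
    using v(2) by (intro restrict_ext) auto
  also have "\<dots> = (\<lambda>t\<in>tuples G 2. 0) \<otimes>\<^bsub>cocycles p G T 2\<^esub> v"
    by (simp add: cocycles_def cochains_def)
  also have "\<dots> \<in> cohomology_class p G T 2 v"
    unfolding cohomology_class_def r_coset_def using zero by blast
  finally show ?thesis
    unfolding cls .
qed

lemma continuous_map_discrete_compose:
  assumes "continuous_map T (discrete_topology A) f" "h ` A \<subseteq> B"
  shows "continuous_map T (discrete_topology B) (\<lambda>g. h (f g))"
proof -
  have "continuous_map (discrete_topology A) (discrete_topology B) h"
    using assms(2) by auto
  from continuous_map_compose[OF assms(1) this] show ?thesis
    by (simp add: o_def)
qed

text \<open>A defining system \<open>a\<close> corresponds to the partial matrix with entries \<open>- a\<close>, and a cochain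
  that bounds its value is the negative of a matching entry in the upper right corner.\<close>

theorem vanishing_triple_massey_lift:
  fixes G :: "'a monoid" (structure)
  assumes G: "group G" and top: "topspace T = carrier G" and p: "0 < p"
    and van: "vanishing_triple_massey p G T"
    and cont: "continuous_map T (discrete_topology UNIV) f12"
      "continuous_map T (discrete_topology UNIV) f23"
      "continuous_map T (discrete_topology UNIV) f34"
      "continuous_map T (discrete_topology UNIV) f13"
      "continuous_map T (discrete_topology UNIV) f24"
    and mult: "\<And>g h. \<lbrakk>g \<in> carrier G; h \<in> carrier G\<rbrakk> \<Longrightarrow> [f12 (g \<otimes> h) = f12 g + f12 h] (mod int p)"
      "\<And>g h. \<lbrakk>g \<in> carrier G; h \<in> carrier G\<rbrakk> \<Longrightarrow> [f23 (g \<otimes> h) = f23 g + f23 h] (mod int p)"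
      "\<And>g h. \<lbrakk>g \<in> carrier G; h \<in> carrier G\<rbrakk> \<Longrightarrow> [f34 (g \<otimes> h) = f34 g + f34 h] (mod int p)"
      "\<And>g h. \<lbrakk>g \<in> carrier G; h \<in> carrier G\<rbrakk> \<Longrightarrow>
        [f13 (g \<otimes> h) = f13 g + f13 h + f12 g * f23 h] (mod int p)"
      "\<And>g h. \<lbrakk>g \<in> carrier G; h \<in> carrier G\<rbrakk> \<Longrightarrow>
        [f24 (g \<otimes> h) = f24 g + f24 h + f23 g * f34 h] (mod int p)"
  obtains f13' f24' f14' where
    "continuous_unitriangular_rep G p f12 f23 f34 f13' f24' f14' T"
proof -
  interpret group G by fact
  \<comment> \<open>The reduction gives values in \<open>{0..<int p}\<close>. The sign matches the
    multiplication rule with the coboundary, where \<open>f (g \<otimes> h)\<close> has the opposite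
    sign, and it cancels in products of two entries.\<close>
  define n where "n f g = (- f g) mod int p" for f :: "'a \<Rightarrow> int" and g
  have n: "[n f g = - f g] (mod int p)" for f g
    by (simp add: n_def cong_def)
  have contn: "continuous_map T (discrete_topology {0..<int p}) (n f)"
    if "continuous_map T (discrete_topology UNIV) f" for f
    unfolding n_def
    using p by (intro continuous_map_discrete_compose[OF that, of "\<lambda>z. (- z) mod int p"]) auto
  define A where "A f = cochain1 G (n f)" for f
  have A1: "A f \<in> carrier (cochains p G T 1)" if "continuous_map T (discrete_topology UNIV) f" for f
    unfolding A_def by (rule cochain1_in_cochains[OF top contn[OF that]])
  have Az: "A f \<in> carrier (cocycles p G T 1)" if "continuous_map T (discrete_topology UNIV) f"
    "\<And>g h. \<lbrakk>g \<in> carrier G; h \<in> carrier G\<rbrakk> \<Longrightarrow> [f (g \<otimes> h) = f g + f h] (mod int p)" for f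
    unfolding A_def cochain1_in_cocycles_iff[OF G top contn[OF that(1)]]
  proof (intro ballI)
    fix g h assume "g \<in> carrier G" "h \<in> carrier G"
    then show "[n f (g \<otimes> h) = n f g + n f h] (mod int p)"
      using that(2)[of g h] n[of f "g \<otimes> h"] n[of f g] n[of f h]
      unfolding cong_iff_dvd_diff dvd_def by algebra
  qed
  have bound_iff: "coboundary p G 1 (cochain1 G u) = cup p G 1 1 (A f) (A f') \<longleftrightarrow>
      (\<forall>g\<in>carrier G. \<forall>h\<in>carrier G. [u h - u (g \<otimes> h) + u g = f g * f' h] (mod int p))" for u f f'
  proof -
    have "[n f g * n f' h = f g * f' h] (mod int p)" for g h
      using cong_mult[OF n[of f g] n[of f' h]] by simp
    then show ?thesis
      unfolding coboundary_cochain1[OF G] cup_cochain1 A_def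
        restrict_tuples2_eq_iff[of "\<lambda>g h. (u h - u (g \<otimes> h) + u g) mod int p" G "\<lambda>g h. (n f g * n f' h) mod int p"]
      by (simp add: cong_def)
  qed
  have single: "cohomology_class p G T 1 u = {u}" if "u \<in> carrier (cocycles p G T 1)" for u
    using that by (intro cohomology_class1[OF p top]) (simp add: cocycles_def)
  have zs: "A f12 \<in> carrier (cocycles p G T 1)" "A f23 \<in> carrier (cocycles p G T 1)"
    "A f34 \<in> carrier (cocycles p G T 1)"
    by (rule Az[OF cont(1) mult(1)] Az[OF cont(2) mult(2)] Az[OF cont(3) mult(3)]; assumption)+
  have "coboundary p G 1 (A f13) = cup p G 1 1 (A f12) (A f23)"
    unfolding A_def[of f13] bound_iff
  proof (intro ballI)
    fix g h assume "g \<in> carrier G" "h \<in> carrier G"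
    then show "[n f13 h - n f13 (g \<otimes> h) + n f13 g = f12 g * f23 h] (mod int p)"
      using mult(4)[of g h] n[of f13 "g \<otimes> h"] n[of f13 g] n[of f13 h]
      unfolding cong_iff_dvd_diff dvd_def by algebra
  qed
  moreover have "coboundary p G 1 (A f24) = cup p G 1 1 (A f23) (A f34)"
    unfolding A_def[of f24] bound_iff
  proof (intro ballI)
    fix g h assume "g \<in> carrier G" "h \<in> carrier G"
    then show "[n f24 h - n f24 (g \<otimes> h) + n f24 g = f23 g * f34 h] (mod int p)"
      using mult(5)[of g h] n[of f24 "g \<otimes> h"] n[of f24 g] n[of f24 h]
      unfolding cong_iff_dvd_diff dvd_def by algebra
  qed
  ultimately have "massey_defining_system p G T {A f12} {A f23} {A f34}
      (A f12) (A f23) (A f34) (A f13) (A f24)"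
    unfolding massey_defining_system_def using zs single A1 cont by simp
  \<comment> \<open>Vanishing concerns only defined products; the given matrix modulo the centre
    shows that this one is defined.\<close>
  then have "triple_massey_product p G T {A f12} {A f23} {A f34} \<noteq> {}"
    unfolding triple_massey_product_def by blast
  moreover have "{u} \<in> carrier (cohomology p G T 1)" if "u \<in> carrier (cocycles p G T 1)" for u
    using single[OF that] that
    by (auto simp: cohomology_def FactGroup_def RCOSETS_def cohomology_class_def)
  ultimately have "\<one>\<^bsub>cohomology p G T 2\<^esub> \<in> triple_massey_product p G T {A f12} {A f23} {A f34}"
    using van zs unfolding vanishing_triple_massey_def by blast
  then obtain a12 a23 a34 a13 a24
    where sys: "massey_defining_system p G T {A f12} {A f23} {A f34} a12 a23 a34 a13 a24"
      and van0: "\<one>\<^bsub>cohomology p G T 2\<^esub> = cohomology_class p G T 2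
        (cup p G 1 1 a12 a24 \<otimes>\<^bsub>cochains p G T 2\<^esub> cup p G 1 1 a13 a34)"
    unfolding triple_massey_product_def by blast
  \<comment> \<open>Classes in degree 1 are singletons, so only \<open>a13\<close> and
    \<open>a24\<close> can differ from the given entries.\<close>
  have a: "a12 = A f12" "a23 = A f23" "a34 = A f34"
    using sys single unfolding massey_defining_system_def by auto
  obtain u13 where u13: "continuous_map T (discrete_topology {0..<int p}) u13" "a13 = cochain1 G u13"
    using sys cochains1_cases[OF top, of a13] unfolding massey_defining_system_def by blast
  obtain u24 where u24: "continuous_map T (discrete_topology {0..<int p}) u24" "a24 = cochain1 G u24"
    using sys cochains1_cases[OF top, of a24] unfolding massey_defining_system_def by blast
  have "coboundary p G 1 (cochain1 G u13) = cup p G 1 1 (A f12) (A f23)"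
    "coboundary p G 1 (cochain1 G u24) = cup p G 1 1 (A f23) (A f34)"
    using sys unfolding massey_defining_system_def a u13(2) u24(2) by simp_all
  note bounds = this[unfolded bound_iff]
  have m13: "[u13 h - u13 (g \<otimes> h) + u13 g = f12 g * f23 h] (mod int p)"
    and m24: "[u24 h - u24 (g \<otimes> h) + u24 g = f23 g * f34 h] (mod int p)"
    if "g \<in> carrier G" "h \<in> carrier G" for g h
    using bounds that by simp_all
  define V where "V g h = (n f12 g * u24 h + u13 g * n f34 h) mod int p" for g h
  have V: "cup p G 1 1 a12 a24 \<otimes>\<^bsub>cochains p G T 2\<^esub> cup p G 1 1 a13 a34
      = (\<lambda>t\<in>tuples G 2. V (t 0) (t 1))" (is "?v = _")
    unfolding a u13(2) u24(2) A_def cup_cochain1 by (auto simp: cochains_def V_def mod_simps)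
  have "?v \<in> coboundaries p G T 2"
  proof (rule mem_coboundaries2[OF G p _ _ _ top])
    show "?v \<in> extensional (tuples G 2)"
      unfolding V by simp
    show "?v t \<in> {0..<int p}" if "t \<in> tuples G 2" for t
      using that p unfolding V by (simp add: V_def)
    show "cohomology_class p G T 2 ?v = coboundaries p G T 2"
      unfolding van0[symmetric] by (simp add: cohomology_def FactGroup_def)
  qed
  then obtain a14 where a14: "a14 \<in> carrier (cochains p G T 1)" "?v = coboundary p G 1 a14"
    by (auto simp: coboundaries_def numeral_2_eq_2)
  obtain u14 where u14: "continuous_map T (discrete_topology {0..<int p}) u14" "a14 = cochain1 G u14"
    using cochains1_cases[OF top a14(1)] .
  have m14: "[u14 h - u14 (g \<otimes> h) + u14 g = - f12 g * u24 h - u13 g * f34 h] (mod int p)"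
    if "g \<in> carrier G" "h \<in> carrier G" for g h
  proof -
    have "V g h = (u14 h - u14 (g \<otimes> h) + u14 g) mod int p"
      using a14(2) that restrict_tuples2_eq_iff[of V G "\<lambda>g h. (u14 h - u14 (g \<otimes> h) + u14 g) mod int p"]
      unfolding V u14(2) coboundary_cochain1[OF G] by blast
    then have "[u14 h - u14 (g \<otimes> h) + u14 g = n f12 g * u24 h + u13 g * n f34 h] (mod int p)"
      by (simp add: V_def cong_def)
    then show ?thesis
      using n[of f12 g] n[of f34 h] unfolding cong_iff_dvd_diff dvd_def by algebra
  qed
  have neg: "continuous_map T (discrete_topology UNIV) (\<lambda>g. - u g)"
    if "continuous_map T (discrete_topology {0..<int p}) u" for u :: "'a \<Rightarrow> int"
    by (rule continuous_map_discrete_compose[OF that]) simp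
  have "continuous_unitriangular_rep G p f12 f23 f34 (\<lambda>g. - u13 g) (\<lambda>g. - u24 g) (\<lambda>g. - u14 g) T"
  proof (unfold_locales; (fact mult cont top | rule neg, fact u13 u24 u14)?)
    fix g h assume gh: "g \<in> carrier G" "h \<in> carrier G"
    show "[- u13 (g \<otimes> h) = - u13 g + - u13 h + f12 g * f23 h] (mod int p)"
      using m13[OF gh] unfolding cong_iff_dvd_diff dvd_def by algebra
    show "[- u24 (g \<otimes> h) = - u24 g + - u24 h + f23 g * f34 h] (mod int p)"
      using m24[OF gh] unfolding cong_iff_dvd_diff dvd_def by algebra
    show "[- u14 (g \<otimes> h) = - u14 g + - u14 h + f12 g * - u24 h + - u13 g * f34 h] (mod int p)"
      using m14[OF gh] unfolding cong_iff_dvd_diff dvd_def by algebra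
  qed
  then show ?thesis
    by (rule that)
qed

section \<open>Representations of free pro-p groups\<close>

text \<open>The trivial subgroup is open, and by Lagrange the order of a quotient divides
  \<open>p ^ n\<close>. This admits the finite unitriangular group as a target of the universal
  property.\<close>

lemma pro_p_group_discrete:
  assumes p: "prime p" and G: "group G" and ord: "order G = p ^ n"
  shows "pro_p_group p G (discrete_topology (carrier G))"
proof -
  interpret group G by fact
  have "0 < order G"
    unfolding ord using prime_gt_0_nat[OF p] by simp
  then have fin: "finite (carrier G)"
    by (simp add: order_def card_gt_0_iff)
  have "topological_group G (discrete_topology (carrier G))"
    unfolding topological_group_def prod_topology_discrete_topology[symmetric]
    using G by auto
  moreover have "\<exists>N. N \<lhd> G \<and> openin (discrete_topology (carrier G)) N \<and> N \<subseteq> U" if "\<one>\<^bsub>G\<^esub> \<in> U" for U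
    using that one_is_normal by (intro exI[of _ "{\<one>\<^bsub>G\<^esub>}"]) auto
  ultimately have "profinite_group G (discrete_topology (carrier G))"
    unfolding profinite_group_def using fin by (simp add: compact_space_discrete_topology)
  moreover have "\<exists>m. order (G Mod N) = p ^ m" if "N \<lhd> G" for N
  proof -
    have "card (rcosets\<^bsub>G\<^esub> N) * card N = p ^ n"
      using lagrange[OF normal_imp_subgroup[OF that]] ord by simp
    then have "order (G Mod N) dvd p ^ n"
      unfolding order_def FactGroup_def by (metis dvd_triv_left partial_object.select_convs(1))
    then show ?thesis
      using divides_primepow_nat[OF p] by blast
  qed
  ultimately show ?thesis
    by (simp add: pro_p_group_def)
qed

text \<open>The tuple \<open>(a, b, c, d, e, f)\<close> stands for the unitriangular matrix with rows
  \<open>(1, a, d, f)\<close>, \<open>(0, 1, b, e)\<close>, \<open>(0, 0, 1, c)\<close>, \<open>(0, 0, 0, 1)\<close>.\<close>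

definition unitriangular_group :: "nat \<Rightarrow> (int \<times> int \<times> int \<times> int \<times> int \<times> int) monoid" where
  "unitriangular_group p =
     \<lparr>carrier = {0..<int p} \<times> {0..<int p} \<times> {0..<int p}
        \<times> {0..<int p} \<times> {0..<int p} \<times> {0..<int p},
      monoid.mult = (\<lambda>(a, b, c, d, e, f) (a', b', c', d', e', f').
        ((a + a') mod int p, (b + b') mod int p, (c + c') mod int p,
         (d + d' + a * b') mod int p, (e + e' + b * c') mod int p,
         (f + f' + a * e' + d * c') mod int p)),
      one = (0, 0, 0, 0, 0, 0)\<rparr>"

lemma group_unitriangular_group:
  assumes "0 < p"
  shows "group (unitriangular_group p)"
proof (rule groupI)
  fix x y z :: "int \<times> int \<times> int \<times> int \<times> int \<times> int"
  obtain a b c d e f a' b' c' d' e' f' a'' b'' c'' d'' e'' f''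
    where xyz: "x = (a, b, c, d, e, f)" "y = (a', b', c', d', e', f')"
      "z = (a'', b'', c'', d'', e'', f'')"
    by (cases x; cases y; cases z)
  show "x \<otimes>\<^bsub>unitriangular_group p\<^esub> y \<otimes>\<^bsub>unitriangular_group p\<^esub> z
      = x \<otimes>\<^bsub>unitriangular_group p\<^esub> (y \<otimes>\<^bsub>unitriangular_group p\<^esub> z)"
    unfolding xyz
    \<comment> \<open>Replacing \<open>u mod p\<close> by \<open>u - p * (u div p)\<close> leaves
      divisibility claims that \<open>algebra\<close> settles as polynomial identities.\<close>
    by (simp add: unitriangular_group_def mod_eq_dvd_iff; intro conjI;
        unfold minus_mult_div_eq_mod[symmetric] dvd_def; algebra)
next
  fix x assume x: "x \<in> carrier (unitriangular_group p)"
  obtain a b c d e f where abc: "x = (a, b, c, d, e, f)"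
    by (cases x)
  \<comment> \<open>These are again the entries of \<open>1 - X + X^2 - X^3\<close>, now reduced
    modulo \<open>p\<close>.\<close>
  let ?y = "((- a) mod int p, (- b) mod int p, (- c) mod int p, (a * b - d) mod int p,
    (b * c - e) mod int p, (a * e + d * c - a * b * c - f) mod int p)"
  have "?y \<otimes>\<^bsub>unitriangular_group p\<^esub> x = \<one>\<^bsub>unitriangular_group p\<^esub>"
    unfolding abc
    by (simp add: unitriangular_group_def mod_eq_0_iff_dvd; intro conjI;
        unfold minus_mult_div_eq_mod[symmetric] dvd_def; algebra)
  moreover have "?y \<in> carrier (unitriangular_group p)"
    using assms by (simp add: unitriangular_group_def)
  ultimately show "\<exists>y\<in>carrier (unitriangular_group p).
      y \<otimes>\<^bsub>unitriangular_group p\<^esub> x = \<one>\<^bsub>unitriangular_group p\<^esub>"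
    by blast
qed (use assms in \<open>auto simp: unitriangular_group_def\<close>)

lemma order_unitriangular_group: "order (unitriangular_group p) = p ^ 6"
  by (simp add: order_def unitriangular_group_def card_cartesian_product eval_nat_numeral)

text \<open>Finite supports make the map from the basis to the unitriangular group converge to 1, so
  the universal property extends it to \<open>S\<close>. The entries are the six coordinates of the
  extension.\<close>

lemma free_pro_p_group_unitriangular_rep:
  assumes p: "prime p" and S: "free_pro_p_group p S T x"
    and fin: "finite {m. f12 m \<noteq> 0}" "finite {m. f23 m \<noteq> 0}" "finite {m. f34 m \<noteq> 0}"
    and ran: "range f12 \<subseteq> {0..<int p}" "range f23 \<subseteq> {0..<int p}" "range f34 \<subseteq> {0..<int p}"
  obtains e12 e23 e34 e13 e24 e14 where
    "continuous_unitriangular_rep S p e12 e23 e34 e13 e24 e14 T"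
    "\<And>m. e12 (x m) = f12 m" "\<And>m. e23 (x m) = f23 m" "\<And>m. e34 (x m) = f34 m"
proof -
  have p0: "0 < p"
    using p by (rule prime_gt_0_nat)
  define f where "f m = (f12 m, f23 m, f34 m, 0 :: int, 0 :: int, 0 :: int)" for m
  let ?U = "unitriangular_group p"
  have U: "pro_p_group p ?U (discrete_topology (carrier ?U))"
    by (rule pro_p_group_discrete[OF p group_unitriangular_group[OF p0] order_unitriangular_group])
  have fU: "range f \<subseteq> carrier ?U"
    using ran p0 by (auto simp: f_def unitriangular_group_def)
  have conv: "converges_to_one ?U (discrete_topology (carrier ?U)) f"
    unfolding converges_to_one_def
  proof (intro allI impI)
    fix N assume "N \<lhd> ?U \<and> openin (discrete_topology (carrier ?U)) N"
    then have "\<one>\<^bsub>?U\<^esub> \<in> N"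
      using normal_imp_subgroup subgroup.one_closed by blast
    then have "{m. f m \<notin> N} \<subseteq> {m. f12 m \<noteq> 0} \<union> {m. f23 m \<noteq> 0} \<union> {m. f34 m \<noteq> 0}"
      by (auto simp: f_def unitriangular_group_def)
    then show "finite {m. f m \<notin> N}"
      by (rule finite_subset) (simp add: fin)
  qed
  obtain \<phi> where \<phi>: "\<phi> \<in> hom S ?U" "continuous_map T (discrete_topology (carrier ?U)) \<phi>"
    "\<And>m. \<phi> (x m) = f m"
    using ex1_implies_ex[OF free_pro_p_group_universal[OF p S U fU conv]] by blast
  have cont: "continuous_map T (discrete_topology UNIV) (\<lambda>g. h (\<phi> g))"
    for h :: "int \<times> int \<times> int \<times> int \<times> int \<times> int \<Rightarrow> int"
    using continuous_map_discrete_compose[OF \<phi>(2), of h UNIV] by simp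
  have tS: "group S" "topspace T = carrier S"
    using S by (auto simp: free_pro_p_group_def pro_p_group_def profinite_group_def topological_group_def)
  \<comment> \<open>The coordinates 0 to 5 are the places (1,2), (2,3), (3,4), (1,3), (2,4),
    (1,4).\<close>
  define \<pi> where "\<pi> = (\<lambda>n (a :: int, b :: int, c :: int, d :: int, e :: int, f :: int). [a, b, c, d, e, f] ! n)"
  have "continuous_unitriangular_rep S p (\<lambda>g. \<pi> 0 (\<phi> g)) (\<lambda>g. \<pi> 1 (\<phi> g)) (\<lambda>g. \<pi> 2 (\<phi> g))
      (\<lambda>g. \<pi> 3 (\<phi> g)) (\<lambda>g. \<pi> 4 (\<phi> g)) (\<lambda>g. \<pi> 5 (\<phi> g)) T"
  proof (intro continuous_unitriangular_rep.intro unitriangular_rep.intro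
      continuous_unitriangular_rep_axioms.intro unitriangular_rep_axioms.intro tS cont)
    fix g h assume gh: "g \<in> carrier S" "h \<in> carrier S"
    have m: "\<phi> (g \<otimes>\<^bsub>S\<^esub> h) = \<phi> g \<otimes>\<^bsub>?U\<^esub> \<phi> h"
      using \<phi>(1) gh by (rule hom_mult)
    show "[\<pi> 0 (\<phi> (g \<otimes>\<^bsub>S\<^esub> h)) = \<pi> 0 (\<phi> g) + \<pi> 0 (\<phi> h)] (mod int p)"
      "[\<pi> 1 (\<phi> (g \<otimes>\<^bsub>S\<^esub> h)) = \<pi> 1 (\<phi> g) + \<pi> 1 (\<phi> h)] (mod int p)"
      "[\<pi> 2 (\<phi> (g \<otimes>\<^bsub>S\<^esub> h)) = \<pi> 2 (\<phi> g) + \<pi> 2 (\<phi> h)] (mod int p)"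
      "[\<pi> 3 (\<phi> (g \<otimes>\<^bsub>S\<^esub> h)) = \<pi> 3 (\<phi> g) + \<pi> 3 (\<phi> h) + \<pi> 0 (\<phi> g) * \<pi> 1 (\<phi> h)] (mod int p)"
      "[\<pi> 4 (\<phi> (g \<otimes>\<^bsub>S\<^esub> h)) = \<pi> 4 (\<phi> g) + \<pi> 4 (\<phi> h) + \<pi> 1 (\<phi> g) * \<pi> 2 (\<phi> h)] (mod int p)"
      "[\<pi> 5 (\<phi> (g \<otimes>\<^bsub>S\<^esub> h)) = \<pi> 5 (\<phi> g) + \<pi> 5 (\<phi> h) + \<pi> 0 (\<phi> g) * \<pi> 4 (\<phi> h)
          + \<pi> 3 (\<phi> g) * \<pi> 2 (\<phi> h)] (mod int p)"
      unfolding m by (cases "\<phi> g"; cases "\<phi> h"; simp add: \<pi>_def unitriangular_group_def cong_def)+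
  qed
  then show ?thesis
    by (rule that) (simp_all add: \<phi>(3) f_def \<pi>_def)
qed

section \<open>Quotients by closed normal subgroups\<close>

lemma closed_normal_subgroup_generated_normal:
  assumes "group G" and top: "topspace T = carrier G" and A: "A \<subseteq> carrier G"
  shows "closed_normal_subgroup_generated G T A \<lhd> G"
proof -
  interpret group G by fact
  have "carrier G \<lhd> G"
    by (rule normal_invI[OF subgroup_self]) simp
  \<comment> \<open>The intersection of an empty family would be the whole type and not a subset of
    the group.\<close>
  then have ne: "{N. N \<lhd> G \<and> closedin T N \<and> A \<subseteq> N} \<noteq> {}"
    using A closedin_topspace[of T] by (auto simp: top)
  show ?thesis
    unfolding closed_normal_subgroup_generated_def
  proof (rule normal_invI)
    show "subgroup (\<Inter>{N. N \<lhd> G \<and> closedin T N \<and> A \<subseteq> N}) G"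
      using ne by (intro subgroups_Inter) (auto intro: normal_imp_subgroup)
    show "g \<otimes>\<^bsub>G\<^esub> h \<otimes>\<^bsub>G\<^esub> inv\<^bsub>G\<^esub> g \<in> \<Inter>{N. N \<lhd> G \<and> closedin T N \<and> A \<subseteq> N}"
      if "g \<in> carrier G" "h \<in> \<Inter>{N. N \<lhd> G \<and> closedin T N \<and> A \<subseteq> N}" for g h
      using that by (auto intro: normal.inv_op_closed2)
  qed
qed

lemma topspace_quotient_group_topology:
  assumes "topspace T = carrier G"
  shows "topspace (quotient_group_topology G T N) = carrier (G Mod N)"
proof -
  have "{g \<in> carrier G. N #>\<^bsub>G\<^esub> g \<in> carrier (G Mod N)} = topspace T"
    using assms by (auto simp: FactGroup_def RCOSETS_def)
  then have "openin (quotient_group_topology G T N) (carrier (G Mod N))"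
    unfolding openin_quotient_group_topology by simp
  then show ?thesis
    unfolding topspace_def openin_quotient_group_topology by blast
qed

text \<open>The quotient topology is final for the projection. The equivalence carries continuity
  both ways: entries on \<open>S\<close> descend to the quotient, and the lift is pulled back to
  \<open>S\<close>.\<close>

lemma continuous_map_quotient_group_topology_discrete:
  assumes top: "topspace T = carrier G"
  shows "continuous_map (quotient_group_topology G T N) (discrete_topology UNIV) f \<longleftrightarrow>
    continuous_map T (discrete_topology UNIV) (\<lambda>g. f (N #>\<^bsub>G\<^esub> g))"
proof -
  have "N #>\<^bsub>G\<^esub> g \<in> carrier (G Mod N)" if "g \<in> carrier G" for g
    using that by (auto simp: FactGroup_def RCOSETS_def)
  then have "{g \<in> carrier G. N #>\<^bsub>G\<^esub> g \<in> {C \<in> carrier (G Mod N). f C \<in> U}}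
      = {g \<in> carrier G. f (N #>\<^bsub>G\<^esub> g) \<in> U}" for U
    by auto
  then show ?thesis
    by (auto simp: continuous_map_def topspace_quotient_group_topology[OF top] top
        openin_quotient_group_topology)
qed

section \<open>Images of canonical decompositions\<close>

lemma (in group) subgroup_nat_pow_closed:
  "subgroup H G \<Longrightarrow> h \<in> H \<Longrightarrow> h [^] (n :: nat) \<in> H"
  by (induction n) (auto simp: subgroup.one_closed subgroup.m_closed)

text \<open>The finite partial products lie in \<open>H\<close>, and a closed set contains their
  limit.\<close>

lemma is_ordered_prod_mem_closed_subgroup:
  fixes G :: "'a monoid" (structure)
  assumes P: "is_ordered_prod G T L f g" and H: "subgroup H G" "closedin T H"
    and f: "\<And>F j. j \<in> set (L F) \<Longrightarrow> f j \<in> H"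
  shows "g \<in> H"
proof -
  have "foldr (\<lambda>j z. f j \<otimes> z) js \<one> \<in> H" if "\<And>j. j \<in> set js \<Longrightarrow> f j \<in> H" for js
    using that by (induction js) (auto simp: subgroup.one_closed[OF H(1)] subgroup.m_closed[OF H(1)])
  with f show ?thesis
    using P H(2) unfolding is_ordered_prod_def
    by (intro limitin_closedin[of T _ g finite_sets_at_top]) auto
qed

lemma distinct_concat_map:
  assumes "distinct xs" "\<And>x. x \<in> set xs \<Longrightarrow> distinct (f x)"
    and "\<And>x y. x \<noteq> y \<Longrightarrow> set (f x) \<inter> set (f y) = {}"
  shows "distinct (concat (map f xs))"
  using assms(1,2)
proof (induction xs)
  case (Cons x xs)
  then have "set (f x) \<inter> set (f y) = {}" if "y \<in> set xs" for y
    using that by (intro assms(3)) auto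
  with Cons show ?case
    by auto
qed simp

text \<open>The factor for \<open>(i, j, k)\<close> must occur only once, since the corner entry
  counts its occurrences.\<close>

lemma distinct_triples: "distinct (triples F)"
  unfolding triples_def by (intro distinct_concat_map) auto

lemma mem_triples: "(i, j, k) \<in> set (triples F) \<Longrightarrow> i < j \<and> k \<le> j"
  by (auto simp: triples_def)

lemma mem_triplesI: "finite F \<Longrightarrow> {i, j, k} \<subseteq> F \<Longrightarrow> i < j \<Longrightarrow> k \<le> j \<Longrightarrow> (i, j, k) \<in> set (triples F)"
  by (auto simp: triples_def)

lemma mem_pairs: "(i, j) \<in> set (pairs F) \<Longrightarrow> i < j"
  by (auto simp: pairs_def)

context unitriangular_rep
begin

text \<open>A conjugate of \<open>h\<close> is \<open>h\<close> times its commutator with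
  \<open>inv g\<close>, which lies one level deeper. For \<open>m = 3\<close> this lets
  \<open>level 3\<close> contain the normal subgroup generated by the relators.\<close>

lemma normal_level:
  assumes "0 < m" "m \<le> 3"
  shows "level m \<lhd> G"
proof (rule normal_invI[OF subgroup_level])
  fix g h assume g: "g \<in> carrier G" and h: "h \<in> level m"
  then have hG: "h \<in> carrier G"
    by (simp add: level_def)
  have "inv g \<in> level 1"
    using g by (simp add: level_def)
  then have "commutator G h (inv g) \<in> level m"
    using commutator_level[OF h, of "inv g" 1] level_antimono[of m "m + 1"] assms by auto
  then have "h \<otimes> commutator G h (inv g) \<in> level m"
    using h subgroup.m_closed[OF subgroup_level] by blast
  moreover have "h \<otimes> commutator G h (inv g) = g \<otimes> h \<otimes> inv g"
    using g hG by (simp add: commutator_def m_assoc[symmetric])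
  ultimately show "g \<otimes> h \<otimes> inv g \<in> level m"
    by simp
qed

lemma foldr_e14:
  assumes "distinct js" "\<And>j. j \<in> set js \<Longrightarrow> f j \<in> level 2"
    and "\<And>j. j \<in> set js \<Longrightarrow> j \<noteq> t \<Longrightarrow> [e14 (f j) = 0] (mod int p)"
  shows "foldr (\<lambda>j z. f j \<otimes> z) js \<one> \<in> level 2"
    "[e14 (foldr (\<lambda>j z. f j \<otimes> z) js \<one>) = (if t \<in> set js then e14 (f t) else 0)] (mod int p)"
  using assms
proof (induction js)
  case Nil
  case 1 show ?case
    by (simp add: subgroup.one_closed[OF subgroup_level])
  case 2 show ?case
    by (simp add: entries_one)
next
  case (Cons j js)
  {
    case 1 then show ?case
      using Cons.IH(1) by (simp add: subgroup.m_closed[OF subgroup_level])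
  next
    case 2
    let ?z = "foldr (\<lambda>j z. f j \<otimes> z) js \<one>"
    have z: "?z \<in> level 2" "[e14 ?z = (if t \<in> set js then e14 (f t) else 0)] (mod int p)"
      using Cons.IH 2 by simp_all
    have "f j \<in> level 2"
      using 2 by simp
    from e14_mult_level2[OF this z(1)] have "[e14 (f j \<otimes> ?z) = e14 (f j) + e14 ?z] (mod int p)" .
    also have "[e14 (f j) + e14 ?z = e14 (f j) + (if t \<in> set js then e14 (f t) else 0)] (mod int p)"
      using z(2) by (intro cong_add cong_refl)
    also have "[e14 (f j) + (if t \<in> set js then e14 (f t) else 0)
        = (if t \<in> set (j # js) then e14 (f t) else 0)] (mod int p)"
    proof (cases "j = t")
      case True
      then show ?thesis using 2 by simp
    next
      case False
      then have "[e14 (f j) = 0] (mod int p)"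
        using 2 by simp
      from cong_add[OF this cong_refl] False show ?thesis
        by simp
    qed
    finally show ?case
      by simp
  }
qed

end

section \<open>Canonical decompositions under a representation with elementary
  superdiagonals\<close>

context continuous_unitriangular_rep
begin

text \<open>All factors lie in \<open>level 3\<close>. Powers do because no basis element has two
  adjacent nonzero superdiagonal entries. Among simple commutators, those of \<open>x i\<close> with
  \<open>x k\<close> and with \<open>x j\<close> are the only exceptions, and the hypotheses on
  \<open>b\<close> remove them.\<close>

lemma canonical_decomposition_mem_level3:
  fixes x :: "'i::wellorder \<Rightarrow> 'a"
  assumes p: "prime p" and x: "range x \<subseteq> carrier G"
    and dec: "canonical_decomposition p G T x s a b c"
    and e: "\<And>m. e12 (x m) = of_bool (m = k)" "\<And>m. e23 (x m) = of_bool (m = i)"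
      "\<And>m. e34 (x m) = of_bool (m = j)"
    and ijk: "i < j" "i \<noteq> k"
    and b: "k < i \<Longrightarrow> b k i = 0" "i < k \<Longrightarrow> b i k = 0" "b i j = 0"
  shows "s \<in> level 3"
proof -
  have xG: "x m \<in> carrier G" for m
    using x by blast
  have x1: "x m \<in> level 1" for m
    using xG by (simp add: level_def)
  note sub = subgroup_level[of 3] closedin_level[of 3]
  note pow = subgroup_nat_pow_closed[OF subgroup_level[of 3]]
  obtain A B C r' where A: "is_ordered_prod G T singles (\<lambda>i. x i [^] (p * a i)) A"
    and B: "is_ordered_prod G T pairs (\<lambda>(i, j). commutator G (x i) (x j) [^] b i j) B"
    and C: "is_ordered_prod G T triples
        (\<lambda>(i, j, k). commutator G (commutator G (x i) (x j)) (x k) [^] c i j k) C"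
    and r': "r' \<in> zassenhaus p G T 4"
    and s: "s = (if p = 2 then A \<otimes> B \<otimes> C \<otimes> r' else if p = 3 then B \<otimes> A \<otimes> C \<otimes> r' else B \<otimes> C \<otimes> r')"
    using dec unfolding canonical_decomposition_def by blast
  have "x m [^] p \<in> level 3" for m
  proof -
    have "e12 (x m) * e23 (x m) = 0" "e23 (x m) * e34 (x m) = 0"
      using ijk by (auto simp: e)
    then show ?thesis
      using entries_pow[OF xG[of m], of p] xG[of m] by (auto simp: level_def cong_0_iff cong_dvd_iff)
  qed
  then have "x m [^] (p * a m) \<in> level 3" for m
    unfolding nat_pow_pow[OF xG, symmetric] by (rule pow)
  then have "A \<in> level 3"
    by (intro is_ordered_prod_mem_closed_subgroup[OF A sub]) auto
  moreover have "commutator G (x m) (x n) [^] b m n \<in> level 3" if "m < n" for m n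
  proof (cases "b m n = 0")
    case True
    then show ?thesis
      using subgroup.one_closed[OF sub(1)] by simp
  next
    case False
    with b that ijk have "\<not> (m = k \<and> n = i)" "\<not> (m = i \<and> n = k)" "\<not> (m = i \<and> n = j)" "\<not> (m = j \<and> n = i)"
      by auto
    then have "commutator G (x m) (x n) \<in> level 3"
      using entries_commutator[OF xG[of m] xG[of n]] commutator_closed[OF xG xG]
      by (auto simp: level_def e)
    then show ?thesis
      by (rule pow)
  qed
  then have "B \<in> level 3"
    by (intro is_ordered_prod_mem_closed_subgroup[OF B sub]) (auto dest: mem_pairs)
  moreover have "commutator G (commutator G (x m) (x n)) (x q) [^] c m n q \<in> level 3" for m n q
    using commutator_level[OF commutator_level[OF x1 x1] x1, of m n q] by (intro pow) (simp add: numeral_3_eq_3)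
  then have "C \<in> level 3"
    by (intro is_ordered_prod_mem_closed_subgroup[OF C sub]) auto
  moreover have "r' \<in> level 3"
    using r' zassenhaus_subset_level[OF p, of 4] level_antimono[of 3 4] by auto
  ultimately show ?thesis
    unfolding s by (metis subgroup.m_closed[OF sub(1)])
qed

text \<open>The entries of the basis elements beyond the first superdiagonal are arbitrary, as they
  are for a lift. All factors except the one for \<open>(i, j, k)\<close> still contribute zero to
  the corner.\<close>

lemma canonical_decomposition_e14:
  fixes x :: "'i::wellorder \<Rightarrow> 'a"
  assumes p: "prime p" and x: "range x \<subseteq> carrier G"
    and dec: "canonical_decomposition p G T x s a b c"
    and e: "\<And>m. e12 (x m) = of_bool (m = k)" "\<And>m. e23 (x m) = of_bool (m = i)"
      "\<And>m. e34 (x m) = of_bool (m = j)"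
    and ijk: "i < j" "k < j" "i \<noteq> k"
    and b: "\<And>m n. m < n \<Longrightarrow> m \<in> {k, j} \<or> n \<in> {k, j} \<Longrightarrow> b m n = 0"
    and a: "p = 2 \<Longrightarrow> a k = 0 \<and> a j = 0"
  shows "[e14 s = - int (c i j k)] (mod int p)"
proof -
  have xG: "x m \<in> carrier G" for m
    using x by blast
  have x1: "x m \<in> level 1" for m
    using xG by (simp add: level_def)
  define H where "H = {g \<in> level 2. [e14 g = 0] (mod int p)}"
  have sub: "subgroup H G" "closedin T H"
    unfolding H_def by (rule subgroup_level2_e14 closedin_level_e14)+
  note pow = subgroup_nat_pow_closed[OF sub(1)]
  have one: "\<one> \<in> H"
    by (rule subgroup.one_closed[OF sub(1)])
  obtain A B C r' where A: "is_ordered_prod G T singles (\<lambda>i. x i [^] (p * a i)) A"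
    and B: "is_ordered_prod G T pairs (\<lambda>(i, j). commutator G (x i) (x j) [^] b i j) B"
    and C: "is_ordered_prod G T triples
        (\<lambda>(i, j, k). commutator G (commutator G (x i) (x j)) (x k) [^] c i j k) C"
    and r': "r' \<in> zassenhaus p G T 4"
    and s: "s = (if p = 2 then A \<otimes> B \<otimes> C \<otimes> r' else if p = 3 then B \<otimes> A \<otimes> C \<otimes> r' else B \<otimes> C \<otimes> r')"
    using dec unfolding canonical_decomposition_def by blast
  have "x m [^] (p * a m) \<in> H" for m
  proof (cases "a m = 0")
    case True
    then show ?thesis
      using one by simp
  next
    case False
    \<comment> \<open>For \<open>p = 2\<close> the quadratic coefficient is 1, but the quadratic
      term contains \<open>e12 (x m)\<close> or \<open>e34 (x m)\<close>, which are nonzero only for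
      \<open>m = k\<close> and \<open>m = j\<close>.\<close>
    have "p = 2 \<Longrightarrow> m \<noteq> k \<and> m \<noteq> j"
      using a False by auto
    moreover have "int p dvd int (p choose 2)" if "p \<noteq> 2"
      using dvd_choose_prime[of 2 p] prime_ge_2_nat[OF p] p that by auto
    ultimately have "int p dvd int (p choose 2) * (e12 (x m) * e24 (x m) + e13 (x m) * e34 (x m))"
      by (cases "p = 2") (auto simp: e)
    moreover have "e12 (x m) * e23 (x m) * e34 (x m) = 0"
      using ijk by (auto simp: e)
    ultimately have "x m [^] p \<in> H"
      using entries_pow[OF xG[of m], of p] xG
      by (auto simp: H_def level_def cong_0_iff cong_dvd_iff)
    then show ?thesis
      unfolding nat_pow_pow[OF xG, symmetric] by (rule pow)
  qed
  then have AH: "A \<in> H"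
    by (intro is_ordered_prod_mem_closed_subgroup[OF A sub]) auto
  have "commutator G (x m) (x n) [^] b m n \<in> H" if "m < n" for m n
  proof (cases "m \<in> {k, j} \<or> n \<in> {k, j}")
    case True
    then show ?thesis
      using one b[OF that] by simp
  next
    case False
    \<comment> \<open>Every term of the corner entry of a simple commutator contains
      \<open>e12\<close> or \<open>e34\<close> of one of the two elements; away from
      \<open>k\<close> and \<open>j\<close> these are zero.\<close>
    then have "commutator G (x m) (x n) \<in> H"
      using entries_commutator[OF xG[of m] xG[of n]] commutator_closed[OF xG xG]
      by (auto simp: H_def level_def e)
    then show ?thesis
      by (rule pow)
  qed
  then have BH: "B \<in> H"
    by (intro is_ordered_prod_mem_closed_subgroup[OF B sub]) (auto dest: mem_pairs)
  have r'H: "r' \<in> H"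
    using r' zassenhaus_subset_level[OF p, of 4] by (auto simp: H_def level_def)
  define f where "f = (\<lambda>(i, j, k). commutator G (commutator G (x i) (x j)) (x k) [^] c i j k)"
  have f2: "f t \<in> level 2" for t
  proof -
    obtain m n q where t: "t = (m, n, q)"
      by (cases t)
    have "commutator G (commutator G (x m) (x n)) (x q) \<in> level 3"
      using commutator_level[OF commutator_level[OF x1 x1] x1, of m n q] by (simp add: numeral_3_eq_3)
    then show ?thesis
      unfolding t f_def using level_antimono[of 2 3]
      by (auto intro: subgroup_nat_pow_closed[OF subgroup_level])
  qed
  have f14: "[e14 (f (m, n, q)) = - int (c m n q) * of_bool ((m, n, q) = (i, j, k))] (mod int p)"
    if mnq: "m < n" "q \<le> n" for m n q
  proof -
    let ?D = "commutator G (x m) (x n)"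
    have DG: "?D \<in> carrier G"
      by (rule commutator_closed[OF xG xG])
    let ?E = "commutator G ?D (x q)"
    have EG: "?E \<in> carrier G"
      by (rule commutator_closed[OF DG xG])
    note D = entries_commutator[OF xG[of m] xG[of n]]
    note E = entries_commutator[OF DG xG[of q]]
    have "[e14 ?E = (e12 (x m) * e23 (x n) - e12 (x n) * e23 (x m)) * e34 (x q)
        - e12 (x q) * (e23 (x m) * e34 (x n) - e23 (x n) * e34 (x m))] (mod int p)"
      using E(6) D(1-5) unfolding cong_iff_dvd_diff dvd_def by algebra
    \<comment> \<open>The first summand needs \<open>q = j\<close> and \<open>m\<close>,
      \<open>n\<close> to be \<open>i\<close>, \<open>k\<close> in some order, so
      \<open>n < j\<close>, against \<open>q \<le> n\<close>. The second needs \<open>q = k\<close>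
      and, since \<open>m < n\<close> and \<open>i < j\<close>, the pair \<open>m = i\<close>,
      \<open>n = j\<close>.\<close>
    also have "(e12 (x m) * e23 (x n) - e12 (x n) * e23 (x m)) * e34 (x q)
        - e12 (x q) * (e23 (x m) * e34 (x n) - e23 (x n) * e34 (x m)) = - of_bool ((m, n, q) = (i, j, k))"
      using ijk mnq by (auto simp: e)
    finally have E14: "[e14 ?E = - of_bool ((m, n, q) = (i, j, k))] (mod int p)" .
    have "[e14 (?E [^] c m n q) = int (c m n q) * e14 ?E] (mod int p)"
      using entries_pow(6)[OF EG, of "c m n q"] E(1-3)
      unfolding cong_iff_dvd_diff dvd_def by algebra
    also have "[int (c m n q) * e14 ?E = int (c m n q) * - of_bool ((m, n, q) = (i, j, k))] (mod int p)"
      using E14 by (intro cong_mult cong_refl)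
    finally show ?thesis
      by (simp add: f_def)
  qed
  have "C \<in> {g \<in> level 2. [e14 g = - int (c i j k)] (mod int p)}"
  proof (rule limitin_closedin)
    show "limitin T (\<lambda>F. foldr (\<lambda>j z. f j \<otimes> z) (triples F) \<one>) C finite_sets_at_top"
      using C by (simp add: is_ordered_prod_def f_def)
    \<comment> \<open>Once \<open>F\<close> contains \<open>i\<close>, \<open>j\<close> and
      \<open>k\<close>, the decisive factor is present and the corner entry no longer changes modulo
      \<open>p\<close>, so the limit inherits it.\<close>
    have "foldr (\<lambda>j z. f j \<otimes> z) (triples F) \<one> \<in> {g \<in> level 2. [e14 g = - int (c i j k)] (mod int p)}"
      if F: "finite F" "{i, j, k} \<subseteq> F" for F
    proof -
      have t: "(i, j, k) \<in> set (triples F)"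
        using F ijk by (intro mem_triplesI) auto
      have other: "[e14 (f t) = 0] (mod int p)" if "t \<in> set (triples F)" "t \<noteq> (i, j, k)" for t
      proof -
        obtain m n q where mnq: "t = (m, n, q)"
          by (cases t)
        with that have "m < n" "q \<le> n"
          using mem_triples by blast+
        from f14[OF this] show ?thesis
          using that(2) unfolding mnq by (simp split: if_splits add: of_bool_def)
      qed
      note fold = foldr_e14[of "triples F" f "(i, j, k)", OF distinct_triples f2 other]
      have "[e14 (foldr (\<lambda>j z. f j \<otimes> z) (triples F) \<one>) = e14 (f (i, j, k))] (mod int p)"
        using fold(2) t by simp
      also have "[e14 (f (i, j, k)) = - int (c i j k)] (mod int p)"
        using f14[of i j k] ijk by simp
      finally show ?thesis
        using fold(1) by simp
    qed
    then show "\<forall>\<^sub>F F in finite_sets_at_top. foldr (\<lambda>j z. f j \<otimes> z) (triples F) \<one>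
        \<in> {g \<in> level 2. [e14 g = - int (c i j k)] (mod int p)}"
      unfolding eventually_finite_subsets_at_top by (intro exI[of _ "{i, j, k}"]) auto
  qed (simp_all add: closedin_level_e14)
  then have C2: "C \<in> level 2" and C14: "[e14 C = - int (c i j k)] (mod int p)"
    by auto
  have add_H: "[e14 (g \<otimes> h) = e14 h] (mod int p)" "[e14 (h \<otimes> g) = e14 h] (mod int p)"
    if "g \<in> H" "h \<in> level 2" for g h
    using that e14_mult_level2[of g h] e14_mult_level2[of h g]
      cong_add[of "e14 g" 0 "int p" "e14 h" "e14 h"]
    by (auto simp: H_def add.commute intro: cong_trans)
  \<comment> \<open>For every \<open>p\<close> the powers and simple commutators that occur stand
    before the triple commutators, so they form one prefix in \<open>H\<close>.\<close>
  define h where "h = (if p = 2 then A \<otimes> B else if p = 3 then B \<otimes> A else B)"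
  have sC: "s = h \<otimes> C \<otimes> r'"
    by (simp add: s h_def)
  have h: "h \<in> H"
    unfolding h_def using AH BH subgroup.m_closed[OF sub(1)] by simp
  then have "h \<otimes> C \<in> level 2"
    using C2 subgroup.m_closed[OF subgroup_level] by (auto simp: H_def)
  then have "[e14 (h \<otimes> C \<otimes> r') = e14 (h \<otimes> C)] (mod int p)"
    by (rule add_H(2)[OF r'H])
  also have "[e14 (h \<otimes> C) = e14 C] (mod int p)"
    by (rule add_H(1)[OF h C2])
  finally show ?thesis
    unfolding sC using C14 by (rule cong_trans)
qed

end

section \<open>The theorem\<close>

theorem theorem7p8:
  fixes p :: nat
    and S :: "'a monoid" and T :: "'a topology"
    and x :: "'i::wellorder \<Rightarrow> 'a"
    and R N :: "'a set"
    and a :: "'a \<Rightarrow> 'i \<Rightarrow> nat"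
    and b :: "'a \<Rightarrow> 'i \<Rightarrow> 'i \<Rightarrow> nat"
    and c :: "'a \<Rightarrow> 'i \<Rightarrow> 'i \<Rightarrow> 'i \<Rightarrow> nat"
    and r :: 'a and i j k :: 'i
  assumes "prime p"
    and "free_pro_p_group p S T x"
    and "R \<subseteq> zassenhaus p S T 2"
    and "\<And>s. s \<in> R \<Longrightarrow> canonical_decomposition p S T x s (a s) (b s) (c s)"
    and "r \<in> R"
    and "i \<noteq> j" "i \<noteq> k" "j \<noteq> k" "i < j" "k < j"
    and "u_exponent (b r) i j = 0" "u_exponent (b r) k j = 0" "u_exponent (b r) k i = 0"
    and "\<And>l. l \<notin> {i, j, k} \<Longrightarrow> u_exponent (b r) k l = 0 \<and> u_exponent (b r) j l = 0"
    and "c r i j k \<noteq> 0"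
    and "p = 2 \<Longrightarrow> a r k = 0 \<and> a r j = 0"
    and "\<And>s. s \<in> R \<Longrightarrow> s \<noteq> r \<Longrightarrow>
           (k < i \<longrightarrow> b s k i = 0) \<and> (i < k \<longrightarrow> b s i k = 0) \<and> b s i j = 0"
    and "N = closed_normal_subgroup_generated S T R"
  shows "\<not> vanishing_triple_massey p (S Mod N) (quotient_group_topology S T N)"
proof
  have p: "prime p" and S: "free_pro_p_group p S T x" and ijk: "i < j" "k < j" "i \<noteq> k"
    and N_def: "N = closed_normal_subgroup_generated S T R"
    using assms by auto
  have p0: "0 < p" and p1: "1 < p"
    using prime_gt_0_nat[OF p] prime_gt_1_nat[OF p] by auto
  have group_S: "group S" and top: "topspace T = carrier S" and x: "range x \<subseteq> carrier S"
    using S by (auto simp: free_pro_p_group_def pro_p_group_def profinite_group_def topological_group_def)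
  interpret S: group S
    by (fact group_S)
  let ?G = "S Mod N" and ?T = "quotient_group_topology S T N"
  let ?k = "\<lambda>m. of_bool (m = k)" and ?i = "\<lambda>m. of_bool (m = i)" and ?j = "\<lambda>m. of_bool (m = j)"
  have fin: "finite {m. of_bool (m = l) \<noteq> (0 :: int)}" for l :: 'i
    by simp
  have ran: "range (\<lambda>m. of_bool (m = l)) \<subseteq> {0..<int p}" for l :: 'i
    using p1 by auto
  obtain e12 e23 e34 e13 e24 e14
    where rep: "continuous_unitriangular_rep S p e12 e23 e34 e13 e24 e14 T"
      and e: "\<And>m. e12 (x m) = ?k m" "\<And>m. e23 (x m) = ?i m" "\<And>m. e34 (x m) = ?j m"
    using free_pro_p_group_unitriangular_rep[OF p S fin[of k] fin[of i] fin[of j]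
        ran[of k] ran[of i] ran[of j]] by blast
  interpret e: continuous_unitriangular_rep S p e12 e23 e34 e13 e24 e14 T
    by (fact rep)
  \<comment> \<open>For \<open>r\<close> the vanishing exponents come from the conditions on
    \<open>u_exponent\<close>, for the other relators from the last hypothesis on
    \<open>R\<close>.\<close>
  have R3: "R \<subseteq> e.level 3"
  proof
    fix s assume s: "s \<in> R"
    have "(k < i \<longrightarrow> b s k i = 0) \<and> (i < k \<longrightarrow> b s i k = 0) \<and> b s i j = 0"
    proof (cases "s = r")
      case True
      then show ?thesis
        using assms(9,11,13) by (auto simp: u_exponent_def split: if_splits)
    next
      case False
      then show ?thesis
        using assms(17) s by blast
    qed
    then show "s \<in> e.level 3"
      using ijk by (intro e.canonical_decomposition_mem_level3[OF p x assms(4)[OF s] e]) auto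
  qed
  have R: "R \<subseteq> carrier S"
    using R3 by (auto simp: e.level_def)
  interpret N: normal N S
    unfolding N_def by (rule closed_normal_subgroup_generated_normal[OF group_S top R])
  have N3: "N \<subseteq> e.level 3"
    unfolding N_def closed_normal_subgroup_generated_def
    using R3 e.normal_level[of 3] e.closedin_level[of 3] by (intro Inter_lower) auto
  have group_G: "group ?G"
    by (rule N.factorgroup_is_group)
  have topG: "topspace ?T = carrier ?G"
    by (rule topspace_quotient_group_topology[OF top])
  \<comment> \<open>An entry is evaluated at a chosen representative of the coset. Modulo
    \<open>p\<close> the choice is harmless for entries invariant under \<open>N\<close>.\<close>
  define q where "q f C = f (SOME g. g \<in> C) mod int p" for f :: "'a \<Rightarrow> int" and C
  have coset_rep: "\<exists>n\<in>N. (SOME g'. g' \<in> N #>\<^bsub>S\<^esub> g) = n \<otimes>\<^bsub>S\<^esub> g" if "g \<in> carrier S" for g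
  proof -
    have "(SOME g'. g' \<in> N #>\<^bsub>S\<^esub> g) \<in> N #>\<^bsub>S\<^esub> g"
      using S.rcos_self[OF that N.subgroup_axioms] by (rule someI)
    then show ?thesis
      by (auto simp: r_coset_def)
  qed
  have q: "q f (N #>\<^bsub>S\<^esub> g) = f g mod int p"
    if "g \<in> carrier S" and "\<And>n. n \<in> N \<Longrightarrow> [f (n \<otimes>\<^bsub>S\<^esub> g) = f g] (mod int p)" for f g
    using coset_rep[OF that(1)] that(2) by (auto simp: q_def cong_def)
  have Ne: "n \<in> carrier S" "[e12 n = 0] (mod int p)" "[e23 n = 0] (mod int p)" "[e34 n = 0] (mod int p)"
    "[e13 n = 0] (mod int p)" "[e24 n = 0] (mod int p)" if "n \<in> N" for n
    using N3 that by (auto simp: e.level_def)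
  \<comment> \<open>The corner entry is absent: elements of \<open>level 3\<close> may have a
    nonzero one, so only the matrix modulo the centre descends.\<close>
  have qe: "q e12 (N #>\<^bsub>S\<^esub> g) = e12 g mod int p" "q e23 (N #>\<^bsub>S\<^esub> g) = e23 g mod int p"
    "q e34 (N #>\<^bsub>S\<^esub> g) = e34 g mod int p" "q e13 (N #>\<^bsub>S\<^esub> g) = e13 g mod int p"
    "q e24 (N #>\<^bsub>S\<^esub> g) = e24 g mod int p" if g: "g \<in> carrier S" for g
  proof -
    have "[e12 (n \<otimes>\<^bsub>S\<^esub> g) = e12 g] (mod int p) \<and> [e23 (n \<otimes>\<^bsub>S\<^esub> g) = e23 g] (mod int p)
        \<and> [e34 (n \<otimes>\<^bsub>S\<^esub> g) = e34 g] (mod int p) \<and> [e13 (n \<otimes>\<^bsub>S\<^esub> g) = e13 g] (mod int p)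
        \<and> [e24 (n \<otimes>\<^bsub>S\<^esub> g) = e24 g] (mod int p)" if "n \<in> N" for n
      using e.mult[OF Ne(1)[OF that] g] Ne(2-6)[OF that]
      unfolding cong_iff_dvd_diff dvd_def by (intro conjI; algebra)
    then show "q e12 (N #>\<^bsub>S\<^esub> g) = e12 g mod int p" "q e23 (N #>\<^bsub>S\<^esub> g) = e23 g mod int p"
      "q e34 (N #>\<^bsub>S\<^esub> g) = e34 g mod int p" "q e13 (N #>\<^bsub>S\<^esub> g) = e13 g mod int p"
      "q e24 (N #>\<^bsub>S\<^esub> g) = e24 g mod int p"
      by (simp_all add: q[OF g])
  qed
  have q_cont: "continuous_map ?T (discrete_topology UNIV) (q f)"
    if f: "continuous_map T (discrete_topology UNIV) f"
      and qf: "\<And>g. g \<in> carrier S \<Longrightarrow> q f (N #>\<^bsub>S\<^esub> g) = f g mod int p" for f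
  proof -
    have "continuous_map T (discrete_topology UNIV) (\<lambda>g. f g mod int p)"
      by (rule continuous_map_discrete_compose[OF f]) simp
    then have "continuous_map T (discrete_topology UNIV) (\<lambda>g. q f (N #>\<^bsub>S\<^esub> g))"
      by (rule continuous_map_eq) (simp add: qf top)
    then show ?thesis
      by (simp add: continuous_map_quotient_group_topology_discrete[OF top])
  qed
  have coset: "\<exists>g\<in>carrier S. C = N #>\<^bsub>S\<^esub> g" if "C \<in> carrier ?G" for C
    using that by (auto simp: FactGroup_def RCOSETS_def)
  have coset_mult: "(N #>\<^bsub>S\<^esub> g) \<otimes>\<^bsub>?G\<^esub> (N #>\<^bsub>S\<^esub> h) = N #>\<^bsub>S\<^esub> (g \<otimes>\<^bsub>S\<^esub> h)"
    if "g \<in> carrier S" "h \<in> carrier S" for g h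
    using N.rcos_sum[OF that] by (simp add: FactGroup_def)
  have coset_closed: "N #>\<^bsub>S\<^esub> g \<in> carrier ?G" if "g \<in> carrier S" for g
    using that by (auto simp: FactGroup_def RCOSETS_def)
  assume van: "vanishing_triple_massey p ?G ?T"
  have q_mult: "[q e12 (C \<otimes>\<^bsub>?G\<^esub> D) = q e12 C + q e12 D] (mod int p)"
      "[q e23 (C \<otimes>\<^bsub>?G\<^esub> D) = q e23 C + q e23 D] (mod int p)"
      "[q e34 (C \<otimes>\<^bsub>?G\<^esub> D) = q e34 C + q e34 D] (mod int p)"
      "[q e13 (C \<otimes>\<^bsub>?G\<^esub> D) = q e13 C + q e13 D + q e12 C * q e23 D] (mod int p)"
      "[q e24 (C \<otimes>\<^bsub>?G\<^esub> D) = q e24 C + q e24 D + q e23 C * q e34 D] (mod int p)"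
    if CD: "C \<in> carrier ?G" "D \<in> carrier ?G" for C D
  proof -
    obtain g h where gh: "g \<in> carrier S" "h \<in> carrier S" and C: "C = N #>\<^bsub>S\<^esub> g" and D: "D = N #>\<^bsub>S\<^esub> h"
      using coset[OF CD(1)] coset[OF CD(2)] by blast
    have ghS: "g \<otimes>\<^bsub>S\<^esub> h \<in> carrier S"
      using gh by simp
    have mod: "[f mod int p = f] (mod int p)" for f
      by (simp add: cong_def)
    note m = e.mult[OF gh]
    note c = cong_trans[OF mod cong_trans[OF _ cong_sym]]
    show "[q e12 (C \<otimes>\<^bsub>?G\<^esub> D) = q e12 C + q e12 D] (mod int p)"
      "[q e23 (C \<otimes>\<^bsub>?G\<^esub> D) = q e23 C + q e23 D] (mod int p)"
      "[q e34 (C \<otimes>\<^bsub>?G\<^esub> D) = q e34 C + q e34 D] (mod int p)"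
      "[q e13 (C \<otimes>\<^bsub>?G\<^esub> D) = q e13 C + q e13 D + q e12 C * q e23 D] (mod int p)"
      "[q e24 (C \<otimes>\<^bsub>?G\<^esub> D) = q e24 C + q e24 D + q e23 C * q e34 D] (mod int p)"
      unfolding C D coset_mult[OF gh] qe[OF gh(1)] qe[OF gh(2)] qe[OF ghS]
      by (rule c, rule m, intro cong_add cong_mult mod)+
  qed
  obtain f13 f24 f14 where f: "continuous_unitriangular_rep ?G p (q e12) (q e23) (q e34) f13 f24 f14 ?T"
    using vanishing_triple_massey_lift[OF group_G topG p0 van q_cont[OF e.cont12 qe(1)]
        q_cont[OF e.cont23 qe(2)] q_cont[OF e.cont34 qe(3)] q_cont[OF e.cont13 qe(4)]
        q_cont[OF e.cont24 qe(5)] q_mult]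
    by blast
  interpret f: continuous_unitriangular_rep ?G p "q e12" "q e23" "q e34" f13 f24 f14 ?T
    by (fact f)
  let ?l = "\<lambda>f g. f (N #>\<^bsub>S\<^esub> g)"
  have lift_cont: "continuous_map T (discrete_topology UNIV) (?l f)"
    if "continuous_map ?T (discrete_topology UNIV) f" for f :: "'a set \<Rightarrow> int"
    using that by (simp add: continuous_map_quotient_group_topology_discrete[OF top])
  \<comment> \<open>The lift is pulled back along the projection, because canonical decompositions
    are products in \<open>S\<close>.\<close>
  interpret l: continuous_unitriangular_rep S p "?l (q e12)" "?l (q e23)" "?l (q e34)" "?l f13" "?l f24"
    "?l f14" T
  proof (intro continuous_unitriangular_rep.intro unitriangular_rep.intro
      continuous_unitriangular_rep_axioms.intro unitriangular_rep_axioms.intro group_S top lift_cont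
      f.cont12 f.cont23 f.cont34 f.cont13 f.cont24 f.cont14)
    fix g h assume gh: "g \<in> carrier S" "h \<in> carrier S"
    show "[?l (q e12) (g \<otimes>\<^bsub>S\<^esub> h) = ?l (q e12) g + ?l (q e12) h] (mod int p)"
      "[?l (q e23) (g \<otimes>\<^bsub>S\<^esub> h) = ?l (q e23) g + ?l (q e23) h] (mod int p)"
      "[?l (q e34) (g \<otimes>\<^bsub>S\<^esub> h) = ?l (q e34) g + ?l (q e34) h] (mod int p)"
      "[?l f13 (g \<otimes>\<^bsub>S\<^esub> h) = ?l f13 g + ?l f13 h + ?l (q e12) g * ?l (q e23) h] (mod int p)"
      "[?l f24 (g \<otimes>\<^bsub>S\<^esub> h) = ?l f24 g + ?l f24 h + ?l (q e23) g * ?l (q e34) h] (mod int p)"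
      "[?l f14 (g \<otimes>\<^bsub>S\<^esub> h) = ?l f14 g + ?l f14 h + ?l (q e12) g * ?l f24 h + ?l f13 g * ?l (q e34) h]
        (mod int p)"
      unfolding coset_mult[OF gh, symmetric]
      by (rule f.mult[OF coset_closed[OF gh(1)] coset_closed[OF gh(2)]])+
  qed
  have xS: "x m \<in> carrier S" for m
    using x by blast
  have le: "q e12 (N #>\<^bsub>S\<^esub> x m) = ?k m" "q e23 (N #>\<^bsub>S\<^esub> x m) = ?i m" "q e34 (N #>\<^bsub>S\<^esub> x m) = ?j m" for m
    using p1 by (simp_all add: qe[OF xS] e)
  have u_sym: "u_exponent (b r) v w = u_exponent (b r) w v" for v w
    by (cases v w rule: linorder_cases) (auto simp: u_exponent_def)
  have u: "u_exponent (b r) v w = 0" if "v \<in> {k, j}" "v \<noteq> w" for v w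
  proof (cases "w \<in> {i, j, k}")
    case True
    then show ?thesis
      using that assms(11-13) u_sym[of i j] u_sym[of k j] by auto
  next
    case False
    then show ?thesis
      using that(1) assms(14)[OF False] by auto
  qed
  have br: "b r m n = 0" if mn: "m < n" "m \<in> {k, j} \<or> n \<in> {k, j}" for m n
  proof -
    have "u_exponent (b r) m n = 0"
      using mn u[of m n] u[of n m] u_sym[of m n] by auto
    with mn(1) show ?thesis
      by (simp add: u_exponent_def)
  qed
  have "[f14 (N #>\<^bsub>S\<^esub> r) = - int (c r i j k)] (mod int p)"
    by (rule l.canonical_decomposition_e14[OF p x assms(4)[OF assms(5)] le ijk br assms(16)])
  \<comment> \<open>The relator \<open>r\<close> becomes trivial in the quotient, so the corner
    entry of its image under the lift is 0 modulo \<open>p\<close>.\<close>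
  moreover have "N #>\<^bsub>S\<^esub> r = \<one>\<^bsub>?G\<^esub>"
  proof -
    have "r \<in> N"
      using assms(5) by (auto simp: N_def closed_normal_subgroup_generated_def)
    then show ?thesis
      using N.rcos_const[OF group_S] by (simp add: FactGroup_def)
  qed
  ultimately have "[- int (c r i j k) = 0] (mod int p)"
    using f.entries_one(6) by (metis cong_sym cong_trans)
  then have "p dvd c r i j k"
    by (simp add: cong_0_iff)
  \<comment> \<open>Canonical exponents are smaller than \<open>p\<close>, so divisibility by
    \<open>p\<close> would force this one to be 0.\<close>
  moreover have "c r i j k < p"
    using assms(4)[OF assms(5)] ijk by (auto simp: canonical_decomposition_def)
  ultimately show False
    using assms(15) by (auto dest: dvd_imp_le)
qed

end
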